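(* Let $q \in \mathrm{SL}(2)$ and let $C^0, C^1 \subseteq T^*_q(\mathrm{SL}(2))$ be the two parts of the conjugate locus defined by $$C^0 = \left\{\lambda_0 : H(q,\lambda_0)\neq 0,\ r_{\lambda_0}>0,\ \sqrt{r_{\lambda_0}} \cos \left(\tfrac{\sqrt{r_{\lambda_0}}}{2}\right)-2 \sin \left(\tfrac{\sqrt{r_{\lambda_0}}}{2}\right) = 0 \right\},$$ $$C^1 = \left\{\lambda_0 : H(q,\lambda_0)\neq 0,\ r_{\lambda_0}>0,\ \sin\left(\tfrac{\sqrt{r_{\lambda_0}}}{2}\right) = 0 \right\}.$$ Then the exponential map $\exp_q : T^*_q(\mathrm{SL}(2)) \to \mathrm{SL}(2)$ is equivalent, in a neighbourhood of $\lambda_0$, to $f : \mathbb{R}^3 \to \mathbb{R}^3 : (x,y,z) \mapsto (x^2,y,z)$ for every $\lambda_0\in C^0$, and to $f : \mathbb{R}^3 \to \mathbb{R}^3 : (x,y,z) \mapsto (xz,y,z)$ for every $\lambda_0 \in C^1$.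
   Context: $\mathrm{SL}(2)$ is the group of real $2\times2$ matrices of determinant $1$. Let $X_0 = \frac12\begin{pmatrix} 0 & -1\\ 1& 0\end{pmatrix}$, $X_1 = \frac12\begin{pmatrix} 1 & 0\\ 0& -1\end{pmatrix}$, $X_2 = \frac12\begin{pmatrix} 0 & 1\\ 1& 0\end{pmatrix}$ be the basis of $\mathfrak{sl}(2)$, regarded as left-invariant vector fields; they satisfy $[X_1,X_2]=-X_0$, $[X_2,X_0]=X_1$, $[X_0,X_1]=X_2$. The sub-Riemannian structure on $\mathrm{SL}(2)$ is the left-invariant one with distribution spanned by $X_1,X_2$ and metric making $X_1,X_2$ orthonormal. The left-invariant metric making $X_0,X_1,X_2$ orthonormal identifies vectors and covectors, so a covector at $q$ is written $\lambda_0 = u_0X_1+v_0X_2+w_0X_0$; set $r_{\lambda_0} = w_0^2-(u_0^2+v_0^2)$. The Hamiltonian is $H(q,\lambda_0)=\frac12(u_0^2+v_0^2)$. The exponential map is $\exp_q(\lambda_0)=\pi(e^{\vec H}(q,\lambda_0))$, where $e^{t\vec H}$ is the Hamiltonian flow of $H$ on $T^*(\mathrm{SL}(2))$ and $\pi$ is the bundle projection onto $\mathrm{SL}(2)$; it is defined on all of $T_q^*(\mathrm{SL}(2))$. "$\exp_q$ is equivalent to $f$ in a neighbourhood of $\lambda_0$" means that there are coordinate charts centered at $\lambda_0$ (in the source) and at $\exp_q(\lambda_0)$ (in the target) in which $\exp_q$ is represented by $f$. *)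

theory Defs
  imports "HOL-Analysis.Analysis"
begin

section \<open>Smooth maps and charts of embedded submanifolds\<close>

text \<open>\<open>Ck_on k f S\<close>: \<open>f\<close> is of class \<open>C\<^sup>k\<close> on \<open>S\<close>. Only meant for open \<open>S\<close>.\<close>

primrec Ck_on ::
  "nat \<Rightarrow> ('a::real_normed_vector \<Rightarrow> 'b::real_normed_vector) \<Rightarrow> 'a set \<Rightarrow> bool" where
  "Ck_on 0 f S \<longleftrightarrow> continuous_on S f"
| "Ck_on (Suc k) f S \<longleftrightarrow>
     (\<forall>x\<in>S. f differentiable (at x)) \<and> (\<forall>v. Ck_on k (\<lambda>x. frechet_derivative f (at x) v) S)"

definition smooth_on ::
  "'a::real_normed_vector set \<Rightarrow> ('a \<Rightarrow> 'b::real_normed_vector) \<Rightarrow> bool" where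
  "smooth_on S f \<longleftrightarrow> (\<forall>k. Ck_on k f S)"

text \<open>Charts with values in \<open>\<real>\<^sup>3\<close> of a three-dimensional embedded submanifold \<open>M\<close> of a Euclidean
  space. As usual for submanifolds, \<open>\<phi>\<close> is smooth on the relatively open set \<open>U\<close> if it is the
  restriction of a smooth map on an open subset of the ambient space.\<close>

definition chart_on :: "'a::euclidean_space set \<Rightarrow> 'a set \<Rightarrow> ('a \<Rightarrow> real^3) \<Rightarrow> bool" where
  "chart_on M U \<phi> \<longleftrightarrow>
     (\<exists>W. open W \<and> U = M \<inter> W \<and> smooth_on W \<phi>) \<and>
     open (\<phi> ` U) \<and>
     (\<exists>g. smooth_on (\<phi> ` U) g \<and> (\<forall>p\<in>U. g (\<phi> p) = p))"

definition centered_chart_on ::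
  "'a::euclidean_space set \<Rightarrow> 'a \<Rightarrow> 'a set \<Rightarrow> ('a \<Rightarrow> real^3) \<Rightarrow> bool" where
  "centered_chart_on M p U \<phi> \<longleftrightarrow> chart_on M U \<phi> \<and> p \<in> U \<and> \<phi> p = 0"

definition locally_equivalent ::
  "'a::euclidean_space set \<Rightarrow> 'b::euclidean_space set \<Rightarrow> ('a \<Rightarrow> 'b) \<Rightarrow> 'a \<Rightarrow> (real^3 \<Rightarrow> real^3) \<Rightarrow> bool"
  where
  "locally_equivalent M N F p f \<longleftrightarrow>
     (\<exists>U \<phi> V \<psi>. centered_chart_on M p U \<phi> \<and> centered_chart_on N (F p) V \<psi> \<and>
        F ` U \<subseteq> V \<and> (\<forall>x\<in>U. \<psi> (F x) = f (\<phi> x)))"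


section \<open>The group \<open>SL(2)\<close> and its left-invariant frame\<close>

definition SL2 :: "(real^2^2) set" where
  "SL2 = {q. det q = 1}"

definition sl2 :: "(real^2^2) set" where
  "sl2 = {\<xi>. trace \<xi> = 0}"

definition X0 :: "real^2^2" where
  "X0 = (1/2) *\<^sub>R vector [vector [0, -1], vector [1, 0]]"

definition X1 :: "real^2^2" where
  "X1 = (1/2) *\<^sub>R vector [vector [1, 0], vector [0, -1]]"

definition X2 :: "real^2^2" where
  "X2 = (1/2) *\<^sub>R vector [vector [0, 1], vector [1, 0]]"

definition left_inv_field :: "real^2^2 \<Rightarrow> real^2^2 \<Rightarrow> real^2^2" where
  "left_inv_field \<xi> q = q ** \<xi>"

definition tangent_SL2 :: "real^2^2 \<Rightarrow> (real^2^2) set" where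
  "tangent_SL2 q = (\<lambda>\<xi>. left_inv_field \<xi> q) ` sl2"

text \<open>The left-invariant metric for which \<open>X0\<close>, \<open>X1\<close>, \<open>X2\<close> are orthonormal: these matrices are
  orthogonal with squared length \<open>1/2\<close> for the Frobenius inner product. The formula makes sense
  for all \<open>A\<close>, \<open>B\<close> and all invertible \<open>q\<close>, not only for tangent vectors to \<open>SL(2)\<close>.\<close>

definition left_inv_metric :: "real^2^2 \<Rightarrow> real^2^2 \<Rightarrow> real^2^2 \<Rightarrow> real" where
  "left_inv_metric q A B = 2 * ((matrix_inv q ** A) \<bullet> (matrix_inv q ** B))"

text \<open>A covector at \<open>q\<close> is given by its coordinates \<open>l = (u, v, w)\<close>: it is identified through the
  metric with the vector \<open>u X1 + v X2 + w X0\<close> at \<open>q\<close>. So \<open>T\<^sub>q\<^sup>*(SL(2))\<close> is the vector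
  space \<open>\<real>\<^sup>3\<close> and \<open>T\<^sup>*(SL(2))\<close> is the submanifold \<open>SL(2) \<times> \<real>\<^sup>3\<close> of a Euclidean space.\<close>

definition covector_vec :: "real^2^2 \<Rightarrow> real^3 \<Rightarrow> real^2^2" where
  "covector_vec q l =
     (l$1) *\<^sub>R left_inv_field X1 q + (l$2) *\<^sub>R left_inv_field X2 q + (l$3) *\<^sub>R left_inv_field X0 q"

definition covector_apply :: "real^2^2 \<Rightarrow> real^3 \<Rightarrow> real^2^2 \<Rightarrow> real" where
  "covector_apply q l A = left_inv_metric q (covector_vec q l) A"

type_synonym phase = "(real^2^2) \<times> (real^3)"

definition cotangent_bundle :: "phase set" where
  "cotangent_bundle = SL2 \<times> UNIV"

definition tangent_cotangent :: "phase \<Rightarrow> phase set" where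
  "tangent_cotangent p = tangent_SL2 (fst p) \<times> UNIV"


section \<open>Hamiltonian flows on the cotangent bundle\<close>

definition liouville_form :: "phase \<Rightarrow> phase \<Rightarrow> real" where
  "liouville_form p W = covector_apply (fst p) (snd p) (fst W)"

text \<open>The canonical symplectic form is the exterior derivative of the Liouville form. It is
  evaluated in the ambient space, in which the Liouville form is smooth near \<open>T\<^sup>*(SL(2))\<close>; on tangent
  vectors to \<open>T\<^sup>*(SL(2))\<close> this agrees with the intrinsic exterior derivative.\<close>

definition symplectic_form :: "phase \<Rightarrow> phase \<Rightarrow> phase \<Rightarrow> real" where
  "symplectic_form p V W =
     frechet_derivative (\<lambda>p'. liouville_form p' W) (at p) V -
     frechet_derivative (\<lambda>p'. liouville_form p' V) (at p) W"

text \<open>The sign convention is the one giving \<open>dq/dt = \<partial>h/\<partial>p\<close>, \<open>dp/dt = -\<partial>h/\<partial>q\<close> in canonical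
  coordinates, in which the Liouville form is \<open>p dq\<close>.\<close>

definition is_hamiltonian_vector :: "(phase \<Rightarrow> real) \<Rightarrow> phase \<Rightarrow> phase \<Rightarrow> bool" where
  "is_hamiltonian_vector h p V \<longleftrightarrow>
     V \<in> tangent_cotangent p \<and>
     (\<forall>W\<in>tangent_cotangent p. symplectic_form p W V = frechet_derivative h (at p) W)"

definition hamiltonian_field :: "(phase \<Rightarrow> real) \<Rightarrow> phase \<Rightarrow> phase" where
  "hamiltonian_field h p = (THE V. is_hamiltonian_vector h p V)"

definition is_hamiltonian_trajectory :: "(phase \<Rightarrow> real) \<Rightarrow> (real \<Rightarrow> phase) \<Rightarrow> bool" where
  "is_hamiltonian_trajectory h \<gamma> \<longleftrightarrow>
     (\<forall>t. \<gamma> t \<in> cotangent_bundle \<and> (\<gamma> has_vector_derivative hamiltonian_field h (\<gamma> t)) (at t))"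

definition hamiltonian_flow :: "(phase \<Rightarrow> real) \<Rightarrow> real \<Rightarrow> phase \<Rightarrow> phase" where
  "hamiltonian_flow h t p = (THE \<gamma>. is_hamiltonian_trajectory h \<gamma> \<and> \<gamma> 0 = p) t"


section \<open>The sub-Riemannian structure\<close>

text \<open>The coordinates of the covector \<open>l\<close> are its values on the frame, so \<open>(l$1)\<^sup>2 + (l$2)\<^sup>2\<close> is the
  sum of the squares of its values on the orthonormal frame \<open>X1\<close>, \<open>X2\<close> of the distribution.\<close>

definition sr_hamiltonian :: "phase \<Rightarrow> real" where
  "sr_hamiltonian p = (1/2) * ((snd p $ 1)\<^sup>2 + (snd p $ 2)\<^sup>2)"

definition sr_exp :: "real^2^2 \<Rightarrow> real^3 \<Rightarrow> real^2^2" where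
  "sr_exp q l = fst (hamiltonian_flow sr_hamiltonian 1 (q, l))"

definition cov_r :: "real^3 \<Rightarrow> real" where
  "cov_r l = (l$3)\<^sup>2 - ((l$1)\<^sup>2 + (l$2)\<^sup>2)"

definition conj_locus0 :: "real^2^2 \<Rightarrow> (real^3) set" where
  "conj_locus0 q = {l. sr_hamiltonian (q, l) \<noteq> 0 \<and> cov_r l > 0 \<and>
     sqrt (cov_r l) * cos (sqrt (cov_r l) / 2) - 2 * sin (sqrt (cov_r l) / 2) = 0}"

definition conj_locus1 :: "real^2^2 \<Rightarrow> (real^3) set" where
  "conj_locus1 q = {l. sr_hamiltonian (q, l) \<noteq> 0 \<and> cov_r l > 0 \<and> sin (sqrt (cov_r l) / 2) = 0}"

end

theory Submission
  imports Defs
begin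

text \<open>The Hamiltonian field is \<open>q' = q (u X1 + v X2)\<close>, \<open>u' = w v\<close>, \<open>v' = - w u\<close>, \<open>w' = 0\<close>, hence
  \<open>exp\<^sub>q (u, v, w) = q exp (u X1 + v X2 - w X0) exp (w X0)\<close>. Writing a \<open>2 \<times> 2\<close> matrix as the
  map \<open>z \<mapsto> \<alpha> z + \<beta> cnj z\<close> of the complex plane, and \<open>\<rho> = sqrt r\<close>, \<open>s = sin (\<rho>/2) / \<rho>\<close>, the point
  \<open>q\<^sup>-\<^sup>1 exp\<^sub>q (u, v, w)\<close> has \<open>\<alpha> = (cos (\<rho>/2) - i s w) exp (i w/2)\<close> and
  \<open>\<beta> = s (u + i v) exp (- i w/2)\<close>. Since \<open>|\<alpha>|\<^sup>2 = 1 + |\<beta>|\<^sup>2\<close>, suitable rotations of \<open>\<alpha>\<close> and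
  \<open>\<beta>\<close> make \<open>(Im \<beta>, Im \<alpha>, Re \<beta>)\<close> a chart at the given point.

  On \<open>C\<^sup>1\<close> the factor \<open>s\<close> vanishes. With \<open>\<beta> = s b\<close>, the functions
  \<open>Im b / Re b\<close>, \<open>Im \<alpha>\<close>, \<open>s Re b\<close> are coordinates at \<open>\<lambda>\<^sub>0\<close>, in which the map is \<open>(x z, y, z)\<close>.

  On \<open>C\<^sup>0\<close> the functions \<open>x = \<rho>/2\<close>, \<open>Im b / Re b\<close> and \<open>g = |\<beta>|\<^sup>2\<close> are coordinates at \<open>\<lambda>\<^sub>0\<close>, and the last
  two factor through the target. The remaining component \<open>Im \<alpha>\<close> is a function \<open>F (x, g)\<close> whose partial
  derivative in \<open>x\<close> is \<open>x cos x - sin x\<close> times a nonvanishing function. So the critical set \<open>x = x\<^sub>0\<close> does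
  not depend on \<open>g\<close>, and by Taylor's formula \<open>F (x, g) - F (x\<^sub>0, g)\<close> is, up to sign, the square of a
  coordinate.\<close>

section \<open>Calculus of smooth maps\<close>

text \<open>On an open set a derivative depends only on the germ, so agreement on \<open>S\<close>
  passes to all iterated derivatives. One implication is proved by induction; the other follows by
  exchanging \<open>f\<close> and \<open>g\<close>.\<close>

lemma Ck_on_cong:
  assumes "open S" "\<And>x. x \<in> S \<Longrightarrow> f x = g x"
  shows "Ck_on k f S \<longleftrightarrow> Ck_on k g S"
proof -
  have "Ck_on k f S \<Longrightarrow> Ck_on k g S" if "\<And>x. x \<in> S \<Longrightarrow> f x = g x" for f g :: "'a \<Rightarrow> 'b"
    using that
  proof (induction k arbitrary: f g)
    case 0
    then show ?case using continuous_on_cong by (metis Ck_on.simps(1))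
  next
    case (Suc k)
    have d: "f differentiable (at x)" if "x \<in> S" for x
      using Suc.prems that by auto
    have e: "frechet_derivative f (at x) = frechet_derivative g (at x)" if "x \<in> S" for x
      using frechet_derivative_transform_within_open[OF d[OF that] \<open>open S\<close> that] Suc.prems by auto
    have "g differentiable (at x)" if "x \<in> S" for x
      using d[OF that] Suc.prems(2) \<open>open S\<close> that
      unfolding differentiable_def by (metis has_derivative_transform_within_open)
    then show ?case
      using Suc.prems Suc.IH[of "\<lambda>x. frechet_derivative f (at x) v" "\<lambda>x. frechet_derivative g (at x) v" for v] e
      by simp
  qed
  then show ?thesis using assms by metis
qed

text \<open>\<open>Ck_on\<close> refers to the chosen \<open>frechet_derivative\<close>; uniqueness
  of derivatives lets an explicit formula \<open>f'\<close> stand in for it.\<close>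

lemma Ck_on_SucI:
  assumes "open S" "\<And>x. x \<in> S \<Longrightarrow> (f has_derivative f' x) (at x)" "\<And>v. Ck_on k (\<lambda>x. f' x v) S"
  shows "Ck_on (Suc k) f S"
proof -
  have "frechet_derivative f (at x) = f' x" if "x \<in> S" for x
    using assms(2)[OF that] frechet_derivative_at by metis
  then have "Ck_on k (\<lambda>x. frechet_derivative f (at x) v) S" for v
    using assms(3)[of v] Ck_on_cong[OF assms(1), of "\<lambda>x. frechet_derivative f (at x) v" "\<lambda>x. f' x v"] by auto
  moreover have "f differentiable (at x)" if "x \<in> S" for x
    using assms(2)[OF that] differentiableI by blast
  ultimately show ?thesis by simp
qed

lemma Ck_on_SucD: "Ck_on (Suc k) f S \<Longrightarrow> Ck_on k f S"
proof (induction k arbitrary: f)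
  case 0
  then show ?case
    by (auto simp: differentiable_imp_continuous_within continuous_at_imp_continuous_on)
qed auto

lemma Ck_on_le: "m \<le> k \<Longrightarrow> Ck_on k f S \<Longrightarrow> Ck_on m f S"
  by (induction rule: dec_induct) (auto dest: Ck_on_SucD simp del: Ck_on.simps)

lemma Ck_on_subset: "Ck_on k f S \<Longrightarrow> T \<subseteq> S \<Longrightarrow> Ck_on k f T"
  by (induction k arbitrary: f) (auto intro: continuous_on_subset)

lemma Ck_on_has_derivative:
  "Ck_on (Suc k) f S \<Longrightarrow> x \<in> S \<Longrightarrow> (f has_derivative frechet_derivative f (at x)) (at x)"
  using frechet_derivative_works by auto

lemma Ck_on_const: "Ck_on k (\<lambda>x. c) S"
  by (induction k arbitrary: c) auto

lemma Ck_on_linear: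
  assumes "bounded_linear f" shows "Ck_on k f S"
proof (cases k)
  case 0
  then show ?thesis using assms by (simp add: linear_continuous_on)
next
  case (Suc m)
  have "(f has_derivative f) (at x)" for x
    using assms by (rule bounded_linear_imp_has_derivative)
  then have "frechet_derivative f (at x) = f" "f differentiable (at x)" for x
    using frechet_derivative_at differentiable_def by metis+
  then show ?thesis using Suc by (simp add: Ck_on_const)
qed

lemma Ck_on_add:
  assumes "open S" "Ck_on k f S" "Ck_on k g S" shows "Ck_on k (\<lambda>x. f x + g x) S"
  using assms(2,3)
proof (induction k arbitrary: f g)
  case 0
  then show ?case by (auto intro: continuous_intros)
next
  case (Suc k)
  show ?case
  proof (rule Ck_on_SucI[OF assms(1)])
    fix x assume "x \<in> S"
    then show "((\<lambda>x. f x + g x) has_derivative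
       (\<lambda>v. frechet_derivative f (at x) v + frechet_derivative g (at x) v)) (at x)"
      by (intro has_derivative_add Ck_on_has_derivative[OF Suc.prems(1)] Ck_on_has_derivative[OF Suc.prems(2)])
  qed (use Suc in auto)
qed

lemma Ck_on_bounded_linear:
  assumes "open S" "bounded_linear L" "Ck_on k f S" shows "Ck_on k (\<lambda>x. L (f x)) S"
  using assms(3)
proof (induction k arbitrary: f)
  case 0
  then show ?case using assms(2) by (auto intro: bounded_linear.continuous_on)
next
  case (Suc k)
  show ?case
    by (rule Ck_on_SucI[OF assms(1), where f' = "\<lambda>x v. L (frechet_derivative f (at x) v)"])
      (use Suc in \<open>auto intro!: bounded_linear.has_derivative[OF assms(2)] Ck_on_has_derivative[OF Suc.prems] simp del: Ck_on.simps(2)\<close>, simp)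
qed

text \<open>Leibniz rule: each summand of the derivative pairs one differentiated factor with one
  undifferentiated factor, whose class is lowered by \<open>Ck_on_SucD\<close>. The induction
  therefore runs over all pairs \<open>f\<close>, \<open>g\<close>.\<close>

lemma Ck_on_bilinear:
  assumes "open S" "bounded_bilinear B" "Ck_on k f S" "Ck_on k g S"
  shows "Ck_on k (\<lambda>x. B (f x) (g x)) S"
  using assms(3,4)
proof (induction k arbitrary: f g)
  case 0
  then show ?case using bounded_bilinear.continuous_on[OF assms(2)] by auto
next
  case (Suc k)
  show ?case
  proof (rule Ck_on_SucI[OF assms(1)])
    fix x assume x: "x \<in> S"
    show "((\<lambda>x. B (f x) (g x)) has_derivative
       (\<lambda>v. B (f x) (frechet_derivative g (at x) v) + B (frechet_derivative f (at x) v) (g x))) (at x)"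
      by (intro bounded_bilinear.FDERIV[OF assms(2)] Ck_on_has_derivative[OF Suc.prems(1) x] Ck_on_has_derivative[OF Suc.prems(2) x])
  next
    fix v
    have "Ck_on k f S" "Ck_on k g S" using Suc.prems Ck_on_SucD by blast+
    then show "Ck_on k (\<lambda>x. B (f x) (frechet_derivative g (at x) v) + B (frechet_derivative f (at x) v) (g x)) S"
      using Suc by (intro Ck_on_add[OF assms(1)] Suc.IH) auto
  qed
qed

lemma Ck_on_sum:
  assumes "open S" "\<And>i. i \<in> I \<Longrightarrow> Ck_on k (f i) S" shows "Ck_on k (\<lambda>x. \<Sum>i\<in>I. f i x) S"
  using assms(2) by (induction I rule: infinite_finite_induct) (simp_all add: Ck_on_const Ck_on_add[OF assms(1)])

lemma linear_eq_sum_Basis: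
  fixes v :: "'a::euclidean_space"
  assumes "linear L" shows "L v = (\<Sum>i\<in>Basis. (v \<bullet> i) *\<^sub>R L i)"
proof -
  have "L v = L (\<Sum>i\<in>Basis. (v \<bullet> i) *\<^sub>R i)" by (simp add: euclidean_representation)
  also have "\<dots> = (\<Sum>i\<in>Basis. (v \<bullet> i) *\<^sub>R L i)"
    using assms by (simp add: linear_sum linear_scale)
  finally show ?thesis .
qed

text \<open>\<open>Ck_on\<close> differentiates in fixed directions only, while the chain rule
  evaluates the derivative of \<open>f\<close> in the moving direction \<open>g'(x) v\<close>.
  Expanding that direction in the basis of the Euclidean middle space leaves a finite sum of
  products, where the induction hypothesis applies to \<open>f'(g x) i\<close> for fixed
  \<open>i\<close>.\<close>

lemma Ck_on_compose:
  fixes f :: "'b::euclidean_space \<Rightarrow> 'c::real_normed_vector" and g :: "'a::real_normed_vector \<Rightarrow> 'b"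
  assumes S: "open S" and "open T" "g ` S \<subseteq> T" "Ck_on k f T" "Ck_on k g S"
  shows "Ck_on k (\<lambda>x. f (g x)) S"
  using assms(4,5)
proof (induction k arbitrary: f)
  case 0
  then show ?case using assms(3) continuous_on_compose2 by fastforce
next
  case (Suc k)
  define D where "D x v = (\<Sum>i\<in>Basis. (frechet_derivative g (at x) v \<bullet> i) *\<^sub>R frechet_derivative f (at (g x)) i)" for x v
  show ?case
  proof (rule Ck_on_SucI[OF S, where f' = D])
    fix x assume x: "x \<in> S"
    then have y: "g x \<in> T" using assms(3) by auto
    have f: "(f has_derivative frechet_derivative f (at (g x))) (at (g x))"
      using Ck_on_has_derivative[OF Suc.prems(1) y] .
    have "((\<lambda>x. f (g x)) has_derivative (\<lambda>v. frechet_derivative f (at (g x)) (frechet_derivative g (at x) v))) (at x)"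
      using has_derivative_compose[OF Ck_on_has_derivative[OF Suc.prems(2) x] f] .
    also have "(\<lambda>v. frechet_derivative f (at (g x)) (frechet_derivative g (at x) v)) = D x"
      unfolding D_def using linear_eq_sum_Basis[OF has_derivative_linear[OF f]] by blast
    finally show "((\<lambda>x. f (g x)) has_derivative D x) (at x)" .
  next
    fix v
    have g: "Ck_on k g S" using Suc.prems Ck_on_SucD by blast
    show "Ck_on k (\<lambda>x. D x v) S" unfolding D_def
    proof (intro Ck_on_sum[OF S] Ck_on_bilinear[OF S bounded_bilinear_scaleR])
      fix i :: 'b assume "i \<in> Basis"
      show "Ck_on k (\<lambda>x. frechet_derivative g (at x) v \<bullet> i) S"
        using Suc.prems(2) by (intro Ck_on_bounded_linear[OF S bounded_linear_inner_left]) simp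
      show "Ck_on k (\<lambda>x. frechet_derivative f (at (g x)) i) S"
        using Suc.prems(1) g by (intro Suc.IH) auto
    qed
  qed
qed

section \<open>Smoothness of composite and elementary functions\<close>

lemma smooth_on_cong: "open S \<Longrightarrow> (\<And>x. x \<in> S \<Longrightarrow> f x = g x) \<Longrightarrow> smooth_on S f \<longleftrightarrow> smooth_on S g"
  using Ck_on_cong unfolding smooth_on_def by metis

lemma smooth_on_subset: "smooth_on S f \<Longrightarrow> T \<subseteq> S \<Longrightarrow> smooth_on T f"
  using Ck_on_subset unfolding smooth_on_def by blast

lemma smooth_on_imp_continuous_on: "smooth_on S f \<Longrightarrow> continuous_on S f"
  unfolding smooth_on_def using Ck_on.simps(1) by blast

lemma smooth_on_has_derivative:
  "smooth_on S f \<Longrightarrow> x \<in> S \<Longrightarrow> (f has_derivative frechet_derivative f (at x)) (at x)"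
  unfolding smooth_on_def using Ck_on_has_derivative by blast

lemma smooth_on_frechet_derivative: "smooth_on S f \<Longrightarrow> smooth_on S (\<lambda>x. frechet_derivative f (at x) v)"
  unfolding smooth_on_def using Ck_on.simps(2) by blast

lemma smooth_on_const: "smooth_on S (\<lambda>x. c)"
  by (simp add: smooth_on_def Ck_on_const)

lemma smooth_on_linear: "bounded_linear f \<Longrightarrow> smooth_on S f"
  by (simp add: smooth_on_def Ck_on_linear)

lemma smooth_on_compose:
  fixes f :: "'b::euclidean_space \<Rightarrow> 'c::real_normed_vector"
  shows "smooth_on T f \<Longrightarrow> open S \<Longrightarrow> open T \<Longrightarrow> (\<And>x. x \<in> S \<Longrightarrow> g x \<in> T) \<Longrightarrow> smooth_on S g \<Longrightarrow> smooth_on S (\<lambda>x. f (g x))"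
  by (simp add: smooth_on_def Ck_on_compose[of S T g] image_subset_iff)

lemma smooth_on_compose_linear: 
  "bounded_linear L \<Longrightarrow> open S \<Longrightarrow> smooth_on S f \<Longrightarrow> smooth_on S (\<lambda>x. L (f x))"
  by (simp add: smooth_on_def Ck_on_bounded_linear)

lemma smooth_on_add:
  "open S \<Longrightarrow> smooth_on S f \<Longrightarrow> smooth_on S g \<Longrightarrow> smooth_on S (\<lambda>x. f x + g x)"
  unfolding smooth_on_def by (simp add: Ck_on_add)

lemma smooth_on_sum:
  "open S \<Longrightarrow> (\<And>i. i \<in> I \<Longrightarrow> smooth_on S (f i)) \<Longrightarrow> smooth_on S (\<lambda>x. \<Sum>i\<in>I. f i x)"
  unfolding smooth_on_def by (simp add: Ck_on_sum)

lemma smooth_on_bilinear: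
  "bounded_bilinear B \<Longrightarrow> open S \<Longrightarrow> smooth_on S f \<Longrightarrow> smooth_on S g \<Longrightarrow> smooth_on S (\<lambda>x. B (f x) (g x))"
  unfolding smooth_on_def by (simp add: Ck_on_bilinear)

lemma smooth_on_mult:
  fixes f g :: "_ \<Rightarrow> real"
  shows "open S \<Longrightarrow> smooth_on S f \<Longrightarrow> smooth_on S g \<Longrightarrow> smooth_on S (\<lambda>x. f x * g x)"
  by (rule smooth_on_bilinear[OF bounded_bilinear_mult])

lemma smooth_on_minus: "open S \<Longrightarrow> smooth_on S f \<Longrightarrow> smooth_on S (\<lambda>x. - f x)"
  by (rule smooth_on_compose_linear[OF bounded_linear_minus[OF bounded_linear_ident]])

lemma smooth_on_diff:
  "open S \<Longrightarrow> smooth_on S f \<Longrightarrow> smooth_on S g \<Longrightarrow> smooth_on S (\<lambda>x. f x - g x)"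
  using smooth_on_add[of S f "\<lambda>x. - g x"] smooth_on_minus[of S g] by simp

lemma smooth_on_power:
  fixes f :: "_ \<Rightarrow> real"
  shows "open S \<Longrightarrow> smooth_on S f \<Longrightarrow> smooth_on S (\<lambda>x. f x ^ n)"
  by (induction n) (simp_all add: smooth_on_const smooth_on_mult)

lemma smooth_on_prod:
  fixes f :: "_ \<Rightarrow> _ \<Rightarrow> real"
  shows "open S \<Longrightarrow> (\<And>i. i \<in> I \<Longrightarrow> smooth_on S (f i)) \<Longrightarrow> smooth_on S (\<lambda>x. \<Prod>i\<in>I. f i x)"
  by (induction I rule: infinite_finite_induct) (simp_all add: smooth_on_const smooth_on_mult)

text \<open>The derivative is a polynomial in \<open>inverse x\<close> itself, so class
  \<open>C^k\<close> bootstraps to class \<open>C^(k+1)\<close>.\<close>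

lemma smooth_on_inverse_real: "smooth_on {x::real. x \<noteq> 0} inverse"
  unfolding smooth_on_def
proof
  have o: "open {x::real. x \<noteq> 0}" by (simp add: open_Collect_neq)
  fix k show "Ck_on k inverse {x::real. x \<noteq> 0}"
  proof (induction k)
    case 0
    then show ?case by (auto intro: continuous_intros)
  next
    case (Suc k)
    have d: "Ck_on k (\<lambda>x. - (inverse x * v * inverse x)) {x::real. x \<noteq> 0}" for v
      by (intro Ck_on_bounded_linear[OF o bounded_linear_minus[OF bounded_linear_ident]]
          Ck_on_bilinear[OF o bounded_bilinear_mult] Suc Ck_on_const)
    show ?case
      by (rule Ck_on_SucI[OF o, where f' = "\<lambda>x v. - (inverse x * v * inverse x)"])
        (use d in \<open>auto intro!: derivative_eq_intros\<close>)
  qed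
qed

lemma smooth_on_inverse:
  fixes f :: "_ \<Rightarrow> real"
  shows "open S \<Longrightarrow> (\<And>x. x \<in> S \<Longrightarrow> f x \<noteq> 0) \<Longrightarrow> smooth_on S f \<Longrightarrow> smooth_on S (\<lambda>x. inverse (f x))"
  by (rule smooth_on_compose[OF smooth_on_inverse_real]) (auto simp: open_Collect_neq)

lemma smooth_on_divide:
  fixes f g :: "_ \<Rightarrow> real"
  shows "open S \<Longrightarrow> (\<And>x. x \<in> S \<Longrightarrow> g x \<noteq> 0) \<Longrightarrow> smooth_on S f \<Longrightarrow> smooth_on S g \<Longrightarrow> smooth_on S (\<lambda>x. f x / g x)"
  by (simp add: divide_inverse smooth_on_mult smooth_on_inverse)

text \<open>The derivative is half the reciprocal of the root itself, which bootstraps as for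
  \<open>inverse\<close>.\<close>

lemma smooth_on_sqrt_real: "smooth_on {x. x > 0} sqrt"
  unfolding smooth_on_def
proof
  have o: "open {x::real. x > 0}" by (simp add: open_Collect_less)
  fix k show "Ck_on k sqrt {x. x > 0}"
  proof (induction k)
    case 0
    then show ?case by (auto intro: continuous_intros)
  next
    case (Suc k)
    have *: "Ck_on k (\<lambda>x. inverse (sqrt x)) {x. x > 0}"
      by (rule Ck_on_compose[OF o _ _ _ Suc, where T = "{x. x \<noteq> 0}"])
        (use smooth_on_inverse_real in \<open>auto simp: open_Collect_neq smooth_on_def\<close>)
    have "Ck_on k (\<lambda>x. v * (inverse (sqrt x) / 2)) {x. x > 0}" for v
      by (intro Ck_on_bilinear[OF o bounded_bilinear_mult] Ck_on_const
         Ck_on_bounded_linear[OF o bounded_linear_divide] *)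
    then show ?case
      by (intro Ck_on_SucI[OF o, where f' = "\<lambda>x v. v * (inverse (sqrt x) / 2)"])
        (auto intro!: derivative_eq_intros)
  qed
qed

lemma smooth_on_sqrt:
  shows "open S \<Longrightarrow> (\<And>x. x \<in> S \<Longrightarrow> f x > 0) \<Longrightarrow> smooth_on S f \<Longrightarrow> smooth_on S (\<lambda>x. sqrt (f x))"
  by (rule smooth_on_compose[OF smooth_on_sqrt_real]) (auto simp: open_Collect_less)

lemma smooth_on_sin_cos_real: "smooth_on UNIV (sin :: real \<Rightarrow> real)" "smooth_on UNIV (cos :: real \<Rightarrow> real)"
proof -
  \<comment> \<open>Arbitrary linear combinations of sine and cosine form a family closed under
    differentiation, which the induction needs.\<close>
  have "Ck_on k (\<lambda>x::real. a * sin x + b * cos x) UNIV" for k a b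
  proof (induction k arbitrary: a b)
    case 0
    show ?case unfolding Ck_on.simps by (intro continuous_intros)
  next
    case (Suc k)
    show ?case
    proof (rule Ck_on_SucI[where f' = "\<lambda>x v. (- b * v) * sin x + (a * v) * cos x"])
      show "Ck_on k (\<lambda>x. (- b * v) * sin x + (a * v) * cos x) UNIV" for v by (rule Suc)
    qed (auto intro!: derivative_eq_intros simp: algebra_simps)
  qed
  from this[of _ 1 0] this[of _ 0 1] show "smooth_on UNIV (sin :: real \<Rightarrow> real)" "smooth_on UNIV (cos :: real \<Rightarrow> real)"
    by (simp_all add: smooth_on_def)
qed

lemma smooth_on_sin: "open S \<Longrightarrow> smooth_on S f \<Longrightarrow> smooth_on S (\<lambda>x. sin (f x :: real))"
  by (rule smooth_on_compose[OF smooth_on_sin_cos_real(1)]) simp_all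

lemma smooth_on_cos: "open S \<Longrightarrow> smooth_on S f \<Longrightarrow> smooth_on S (\<lambda>x. cos (f x :: real))"
  by (rule smooth_on_compose[OF smooth_on_sin_cos_real(2)]) simp_all

lemma bounded_linear_axis: "bounded_linear (axis i :: 'a::euclidean_space \<Rightarrow> 'a^'n)"
  by (intro linear_conv_bounded_linear[THEN iffD1] linearI) (auto simp: axis_def vec_eq_iff)

lemma smooth_on_vec:
  fixes f :: "_ \<Rightarrow> 'a::euclidean_space^'n"
  assumes "open S" "\<And>i. smooth_on S (\<lambda>x. f x $ i)"
  shows "smooth_on S f"
proof -
  have "f x = (\<Sum>i\<in>UNIV. axis i (f x $ i))" for x
    by (simp add: vec_eq_iff axis_def if_distrib cong: if_cong)
  then have "f = (\<lambda>x. \<Sum>i\<in>UNIV. axis i (f x $ i))" by blast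
  moreover have "smooth_on S (\<lambda>x. \<Sum>i\<in>UNIV. axis i (f x $ i))"
    using assms by (intro smooth_on_sum smooth_on_compose_linear[OF bounded_linear_axis])
  ultimately show ?thesis by simp
qed

lemma smooth_on_vector3:
  fixes a b c :: "_ \<Rightarrow> real"
  assumes "open S" "smooth_on S a" "smooth_on S b" "smooth_on S c"
  shows "smooth_on S (\<lambda>x. vector [a x, b x, c x] :: real^3)"
proof (rule smooth_on_vec[OF assms(1)])
  show "smooth_on S (\<lambda>x. (vector [a x, b x, c x] :: real^3) $ i)" for i
    using exhaust_3[of i] assms(2-4) by (elim disjE) simp_all
qed

lemma smooth_on_Pair:
  assumes "open S" "smooth_on S f" "smooth_on S g"
  shows "smooth_on S (\<lambda>x. (f x, g x))"
proof -
  have "smooth_on S (\<lambda>x. (f x, 0))" "smooth_on S (\<lambda>x. (0, g x))"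
    using smooth_on_compose_linear[OF bounded_linear_Pair[OF bounded_linear_ident bounded_linear_zero] assms(1,2)]
      smooth_on_compose_linear[OF bounded_linear_Pair[OF bounded_linear_zero bounded_linear_ident] assms(1,3)]
    by simp_all
  from smooth_on_add[OF assms(1) this] show ?thesis by simp
qed

lemmas smooth_on_ident = smooth_on_linear[OF bounded_linear_ident]
lemmas smooth_on_fst = smooth_on_compose_linear[OF bounded_linear_fst]
lemmas smooth_on_snd = smooth_on_compose_linear[OF bounded_linear_snd]
lemmas smooth_on_nth = smooth_on_compose_linear[OF bounded_linear_vec_nth]

lemmas smooth_intros = smooth_on_const smooth_on_ident smooth_on_fst smooth_on_snd smooth_on_nth
  smooth_on_add smooth_on_diff smooth_on_minus smooth_on_mult smooth_on_power smooth_on_divide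
  smooth_on_sqrt smooth_on_sin smooth_on_cos smooth_on_Pair smooth_on_vector3

section \<open>Local diffeomorphisms and charts\<close>

lemma smooth_on_det:
  fixes A :: "'a::real_normed_vector \<Rightarrow> real^'n^'n"
  assumes "open S" "\<And>i j. smooth_on S (\<lambda>x. A x $ i $ j)"
  shows "smooth_on S (\<lambda>x. det (A x))"
  unfolding det_def by (simp add: assms smooth_on_sum smooth_on_mult smooth_on_prod smooth_on_const)

text \<open>Cramer's rule: the components of the solution of \<open>f'(x) z = v\<close> are
  quotients of determinants with smooth entries. \<open>B k x\<close> is the Jacobian with column
  \<open>k\<close> replaced by \<open>v\<close>.\<close>

lemma smooth_on_inv_frechet_derivative:
  fixes f :: "real^'n \<Rightarrow> real^'n"
  assumes "open S" "smooth_on S f" "\<And>x. x \<in> S \<Longrightarrow> bij (frechet_derivative f (at x))"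
  shows "smooth_on S (\<lambda>x. inv (frechet_derivative f (at x)) v)"
proof -
  define D where "D x = frechet_derivative f (at x)" for x
  define A where "A x = matrix (D x)" for x
  define B where "B k x = (\<chi> i j. if j = k then v $ i else A x $ i $ j)" for k x
  have sA: "smooth_on S (\<lambda>x. A x $ i $ j)" for i j
    unfolding A_def matrix_def D_def
    by (simp add: smooth_on_nth smooth_on_frechet_derivative assms)
  have sB: "smooth_on S (\<lambda>x. B k x $ i $ j)" for k i j
    using sA by (cases "j = k") (simp_all add: B_def smooth_on_const)
  have lin: "linear (D x)" if "x \<in> S" for x
    unfolding D_def using smooth_on_has_derivative[OF assms(2) that] has_derivative_linear by blast
  have det: "det (A x) \<noteq> 0" if "x \<in> S" for x
    using assms(3)[OF that] lin[OF that] bij_is_inj det_nz_iff_inj unfolding A_def D_def by blast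
  have "smooth_on S (\<lambda>x. \<chi> k. det (B k x) / det (A x))"
    by (rule smooth_on_vec[OF assms(1)])
      (simp add: smooth_on_divide smooth_on_det sA sB det assms(1))
  moreover have "inv (D x) v = (\<chi> k. det (B k x) / det (A x))" if "x \<in> S" for x
  proof -
    have "A x *v inv (D x) v = v"
      unfolding A_def using matrix_works[of "D x"] lin[OF that] assms(3)[OF that]
      by (simp add: linear_matrix_vector_mul_eq D_def bij_is_surj surj_f_inv_f)
    then show ?thesis using cramer[OF det[OF that]] unfolding B_def by blast
  qed
  ultimately show ?thesis
    unfolding D_def using smooth_on_cong[OF assms(1)] by (metis (no_types, lifting))
qed

text \<open>The inverse function theorem supplies \<open>g\<close> with \<open>g'(y)\<close> inverse
  to \<open>f'(g y)\<close>. If \<open>g\<close> is of class \<open>C^k\<close>, this formula makes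
  \<open>g'\<close> of class \<open>C^k\<close>, hence \<open>g\<close> of class
  \<open>C^(k+1)\<close>.\<close>

lemma smooth_inverse_function:
  fixes f :: "real^'n \<Rightarrow> real^'n"
  assumes S: "open S" and f: "smooth_on S f" and p: "p \<in> S"
    and inj: "\<And>v. frechet_derivative f (at p) v = 0 \<Longrightarrow> v = 0"
  obtains U g where "open U" "p \<in> U" "U \<subseteq> S" "open (f ` U)" "smooth_on (f ` U) g" "\<And>x. x \<in> U \<Longrightarrow> g (f x) = x"
proof -
  define D where "D x = frechet_derivative f (at x)" for x
  have der: "(f has_derivative D x) (at x)" if "x \<in> S" for x
    unfolding D_def by (rule smooth_on_has_derivative[OF f that])
  have bl: "blinfun_apply (Blinfun (D x)) = D x" if "x \<in> S" for x
    using der[OF that] by (simp add: bounded_linear_Blinfun_apply has_derivative_bounded_linear)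
  have der': "(f has_derivative blinfun_apply (Blinfun (D x))) (at x)" if "x \<in> S" for x
    using der[OF that] bl[OF that] by simp
  \<comment> \<open>In finite dimension, continuity of an operator-valued map can be tested on
    single directions.\<close>
  have cont: "continuous_on S (\<lambda>x. Blinfun (D x))"
  proof (rule continuous_on_blinfun_componentwise)
    fix i :: "real^'n"
    have "continuous_on S (\<lambda>x. D x i)"
      unfolding D_def using f smooth_on_frechet_derivative smooth_on_imp_continuous_on by blast
    then show "continuous_on S (\<lambda>x. blinfun_apply (Blinfun (D x)) i)"
      using continuous_on_cong[OF refl, of S "\<lambda>x. blinfun_apply (Blinfun (D x)) i" "\<lambda>x. D x i"] bl by simp
  qed
  have linp: "linear (D p)" using der[OF p] has_derivative_linear by blast
  moreover have "inj (D p)"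
    using linear_injective_0[OF linp] inj unfolding D_def by blast
  ultimately obtain I where "linear I" "\<And>x. I (D p x) = x"
    using linear_injective_isomorphism by blast
  then have inv: "Blinfun I o\<^sub>L Blinfun (D p) = id_blinfun"
    using bl[OF p] by (intro blinfun_eqI) (simp add: bounded_linear_Blinfun_apply linear_conv_bounded_linear)
  obtain U V g g' where U: "open U" "U \<subseteq> S" "p \<in> U" and V: "open V" "f p \<in> V" and hom: "homeomorphism U V f g"
    and g: "\<And>y. y \<in> V \<Longrightarrow> (g has_derivative g' y) (at y)"
    and g': "\<And>y. y \<in> V \<Longrightarrow> g' y = inv (blinfun_apply (Blinfun (D (g y))))"
    and bij: "\<And>y. y \<in> V \<Longrightarrow> bij (blinfun_apply (Blinfun (D (g y))))"
  proof (rule inverse_function_theorem[OF S der' cont p inv], assumption, goal_cases)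
    case (1 U V g g')
    show ?case by (rule 1(1)[OF 1(2-)])
  qed
  have VU: "V = f ` U" "g ` V = U" and gf: "\<And>x. x \<in> U \<Longrightarrow> g (f x) = x"
    using hom by (auto simp: homeomorphism_def)
  have bij': "bij (frechet_derivative f (at x))" if "x \<in> U" for x
  proof -
    have "f x \<in> V" "x \<in> S" using that VU U(2) by auto
    then show ?thesis using bij[of "f x"] bl[of x] gf[OF that] by (simp add: D_def)
  qed
  have "Ck_on k g V" for k
  proof (induction k)
    case 0
    then show ?case using hom by (simp add: homeomorphism_def)
  next
    case (Suc k)
    show ?case
    proof (rule Ck_on_SucI[OF V(1) g])
      fix v
      have "smooth_on U (\<lambda>x. inv (frechet_derivative f (at x)) v)"
        using bij' f U smooth_on_subset by (intro smooth_on_inv_frechet_derivative) auto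
      then have "Ck_on k (\<lambda>x. inv (frechet_derivative f (at x)) v) U"
        by (simp add: smooth_on_def)
      from Ck_on_compose[OF V(1) U(1) equalityD1[OF VU(2)] this Suc]
      have "Ck_on k (\<lambda>y. inv (frechet_derivative f (at (g y))) v) V" .
      moreover have "g' y v = inv (frechet_derivative f (at (g y))) v" if "y \<in> V" for y
      proof -
        have "g y \<in> S" using that VU(2) U(2) by blast
        then show ?thesis using g'[OF that] bl by (simp add: D_def)
      qed
      ultimately show "Ck_on k (\<lambda>y. g' y v) V"
        using Ck_on_cong[OF V(1), of "\<lambda>y. g' y v" "\<lambda>y. inv (frechet_derivative f (at (g y))) v"] by simp
    qed
  qed
  then have "smooth_on (f ` U) g" using VU(1) by (simp add: smooth_on_def)
  then show ?thesis
    using that U(1,3,2) V(1) gf unfolding VU(1) by blast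
qed

lemma local_diffeo_chart_on:
  fixes f :: "real^3 \<Rightarrow> real^3"
  assumes "open S" "smooth_on S f" "p \<in> S" "\<And>v. frechet_derivative f (at p) v = 0 \<Longrightarrow> v = 0"
  obtains U where "open U" "p \<in> U" "U \<subseteq> S" "chart_on UNIV U f"
proof -
  obtain U g where U: "open U" "p \<in> U" "U \<subseteq> S" "open (f ` U)" "smooth_on (f ` U) g" "\<And>x. x \<in> U \<Longrightarrow> g (f x) = x"
    using smooth_inverse_function[OF assms] by blast
  have "chart_on UNIV U f"
    unfolding chart_on_def using U smooth_on_subset[OF assms(2)] by (metis Int_UNIV_left)
  then show ?thesis using that U by blast
qed

section \<open>Restricting and composing charts\<close>

lemma chart_on_Int_open:
  assumes "chart_on M U \<phi>" "open W" shows "chart_on M (U \<inter> W) \<phi>"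
proof -
  obtain W' g where W': "open W'" "U = M \<inter> W'" "smooth_on W' \<phi>" and op: "open (\<phi> ` U)"
    and g: "smooth_on (\<phi> ` U) g" "\<And>p. p \<in> U \<Longrightarrow> g (\<phi> p) = p"
    using assms(1) unfolding chart_on_def by blast
  have "\<phi> ` (U \<inter> W) = \<phi> ` U \<inter> g -` W" using g(2) by auto
  moreover have "open (\<phi> ` U \<inter> g -` W)"
    using continuous_open_preimage[OF smooth_on_imp_continuous_on[OF g(1)] op assms(2)] .
  ultimately have "open (\<phi> ` (U \<inter> W))" by simp
  moreover have "open (W' \<inter> W)" "U \<inter> W = M \<inter> (W' \<inter> W)" "smooth_on (W' \<inter> W) \<phi>"
    using W' assms(2) smooth_on_subset[OF W'(3) Int_lower1] by auto
  moreover have "smooth_on (\<phi> ` (U \<inter> W)) g" using smooth_on_subset[OF g(1), of "\<phi> ` (U \<inter> W)"] by blast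
  ultimately show ?thesis unfolding chart_on_def using g(2) by blast
qed

text \<open>Used to straighten a chart of the target by a local diffeomorphism of three-space. The
  new image is open, being a preimage under the continuous inverse \<open>h\<close>.\<close>

lemma chart_on_compose:
  assumes "chart_on M U \<phi>" "chart_on UNIV U' \<kappa>"
  shows "chart_on M (U \<inter> \<phi> -` U') (\<lambda>p. \<kappa> (\<phi> p))"
proof -
  obtain W g where W: "open W" "U = M \<inter> W" "smooth_on W \<phi>" and op: "open (\<phi> ` U)"
    and g: "smooth_on (\<phi> ` U) g" "\<And>p. p \<in> U \<Longrightarrow> g (\<phi> p) = p"
    using assms(1) unfolding chart_on_def by blast
  obtain h where U': "open U'" "smooth_on U' \<kappa>" and op': "open (\<kappa> ` U')"
    and h: "smooth_on (\<kappa> ` U') h" "\<And>p. p \<in> U' \<Longrightarrow> h (\<kappa> p) = p"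
    using assms(2) unfolding chart_on_def by auto
  let ?W = "W \<inter> \<phi> -` U'" and ?I = "(\<lambda>p. \<kappa> (\<phi> p)) ` (U \<inter> \<phi> -` U')"
  have oW: "open ?W"
    using continuous_open_preimage[OF smooth_on_imp_continuous_on[OF W(3)] W(1) U'(1)] .
  have "smooth_on ?W (\<lambda>p. \<kappa> (\<phi> p))"
    using smooth_on_subset[OF W(3), of ?W] by (intro smooth_on_compose[OF U'(2) oW U'(1)]) auto
  moreover have "?I = \<kappa> ` U' \<inter> h -` (\<phi> ` U)"
    using h(2) by (force simp: image_iff)
  then have oI: "open ?I"
    using continuous_open_preimage[OF smooth_on_imp_continuous_on[OF h(1)] op' op] by simp
  moreover have "smooth_on ?I (\<lambda>y. g (h y))"
    using h(2) smooth_on_subset[OF h(1), of ?I] by (intro smooth_on_compose[OF g(1) oI op]) auto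
  moreover have "\<forall>p\<in>U \<inter> \<phi> -` U'. g (h (\<kappa> (\<phi> p))) = p" using g(2) h(2) by auto
  moreover have "U \<inter> \<phi> -` U' = M \<inter> ?W" using W(2) by auto
  ultimately show ?thesis unfolding chart_on_def using oW by (metis (no_types, lifting))
qed

text \<open>The inverse function theorem makes \<open>\<phi>\<close> a chart near \<open>p\<close>;
  its domain is then shrunk so that \<open>F\<close> lands in the target chart.\<close>

lemma locally_equivalentI:
  fixes \<phi> :: "real^3 \<Rightarrow> real^3"
  assumes "open S" "smooth_on S \<phi>" "p \<in> S" "\<phi> p = 0"
    and inj: "\<And>v. frechet_derivative \<phi> (at p) v = 0 \<Longrightarrow> v = 0"
    and F: "continuous_on S F" "F ` S \<subseteq> N"
    and \<psi>: "centered_chart_on N (F p) V \<psi>"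
    and eq: "\<And>x. x \<in> S \<Longrightarrow> F x \<in> V \<Longrightarrow> \<psi> (F x) = f (\<phi> x)"
  shows "locally_equivalent UNIV N F p f"
proof -
  obtain U where U: "open U" "p \<in> U" "U \<subseteq> S" "chart_on UNIV U \<phi>"
    using local_diffeo_chart_on[OF assms(1-3)] inj by metis
  obtain W where W: "open W" "V = N \<inter> W"
    using \<psi> unfolding centered_chart_on_def chart_on_def by blast
  have "F p \<in> V" using \<psi> unfolding centered_chart_on_def by blast
  let ?U = "U \<inter> (S \<inter> F -` W)"
  have "open (S \<inter> F -` W)"
    using continuous_open_preimage[OF F(1) assms(1) W(1)] .
  then have "chart_on UNIV ?U \<phi>" by (rule chart_on_Int_open[OF U(4)])
  then have "centered_chart_on UNIV p ?U \<phi>"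
    unfolding centered_chart_on_def using U(2) assms(3,4) \<open>F p \<in> V\<close> W by auto
  moreover have "F ` ?U \<subseteq> V" using F(2) W by auto
  moreover have "\<forall>x\<in>?U. \<psi> (F x) = f (\<phi> x)" using \<open>F ` ?U \<subseteq> V\<close> eq by blast
  ultimately show ?thesis unfolding locally_equivalent_def using \<psi> by blast
qed

section \<open>The Morse lemma with parameters\<close>

text \<open>Differentiation under the integral sign: the derivative is again a parameter integral,
  with a partial derivative of \<open>P\<close> as integrand, so the induction runs over all
  \<open>P\<close>. The open set \<open>\<Omega>\<close> makes \<open>P\<close> differentiable at
  the end points of the segment too.\<close>

lemma Ck_on_integral_param:
  fixes P :: "real \<times> 'a::euclidean_space \<Rightarrow> real"
  assumes "open \<Omega>" "open S" and sub: "{0..1} \<times> S \<subseteq> \<Omega>" and "Ck_on k P \<Omega>"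
  shows "Ck_on k (\<lambda>p. integral {0..1} (\<lambda>t. P (t, p))) S"
  using assms(4)
proof (induction k arbitrary: P)
  have cont: "continuous_on (B \<times> {0..1}) (\<lambda>(p, t). Q (t, p))" if "continuous_on \<Omega> Q" "B \<subseteq> S"
    for B and Q :: "real \<times> 'a \<Rightarrow> real"
    unfolding split_beta using subsetD[OF sub] subsetD[OF that(2)]
    by (intro continuous_on_compose2[OF that(1)] continuous_intros) auto
  {
    case 0
    then show ?case
      using integral_continuous_on_param[of S 0 1 "\<lambda>p t. P (t, p)"] cont[of P S] by simp
  next
    case (Suc k)
    define D where "D p t v = frechet_derivative P (at (t, p)) (0, v)" for p t v
    have derP: "((\<lambda>p. P (t, p)) has_derivative D p t) (at p)" if "p \<in> S" "t \<in> {0..1}" for p t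
    proof -
      have "(t, p) \<in> \<Omega>" using that sub by auto
      from has_derivative_compose[OF has_derivative_Pair[OF has_derivative_const has_derivative_ident] Ck_on_has_derivative[OF Suc.prems this]]
      show ?thesis unfolding D_def by simp
    qed
    have bl: "blinfun_apply (Blinfun (D p t)) = D p t" if "p \<in> S" "t \<in> {0..1}" for p t
      using derP[OF that] by (simp add: bounded_linear_Blinfun_apply has_derivative_bounded_linear)
    have contD: "continuous_on (S \<times> {0..1}) (\<lambda>(p, t). Blinfun (D p t))"
    proof (rule continuous_on_blinfun_componentwise)
      fix i :: 'a
      have "Ck_on k (\<lambda>q. frechet_derivative P (at q) (0, i)) \<Omega>" using Suc.prems by simp
      then have "Ck_on 0 (\<lambda>q. frechet_derivative P (at q) (0, i)) \<Omega>"
        by (rule Ck_on_le[rotated]) simp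
      then have "continuous_on \<Omega> (\<lambda>q. frechet_derivative P (at q) (0, i))" by simp
      from cont[OF this order_refl]
      have "continuous_on (S \<times> {0..1}) (\<lambda>(p, t). D p t i)" unfolding D_def .
      then show "continuous_on (S \<times> {0..1}) (\<lambda>x. blinfun_apply (case x of (p, t) \<Rightarrow> Blinfun (D p t)) i)"
        by (rule continuous_on_cong[THEN iffD1, rotated -1]) (auto simp: bl)
    qed
    show ?case
    proof (rule Ck_on_SucI[OF assms(2)])
      fix p assume p: "p \<in> S"
      obtain e where e: "e > 0" "ball p e \<subseteq> S" using assms(2) p openE by blast
      \<comment> \<open>\<open>leibniz_rule\<close> works on a convex set, so it is applied on a
        ball around \<open>p\<close>.\<close>
      have "((\<lambda>p. integral (cbox 0 1) (\<lambda>t. P (t, p))) has_derivative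
              integral (cbox 0 1) (\<lambda>t. Blinfun (D p t))) (at p within ball p e)"
      proof (rule leibniz_rule)
        show "((\<lambda>p. P (t, p)) has_derivative blinfun_apply (Blinfun (D q t))) (at q within ball p e)"
          if "q \<in> ball p e" "t \<in> cbox 0 1" for q t
        proof -
          have "q \<in> S" "t \<in> {0..1}" using that e(2) by auto
          then show ?thesis using derP bl has_derivative_at_withinI by metis
        qed
        show "continuous_on (ball p e \<times> cbox 0 1) (\<lambda>(p, t). Blinfun (D p t))"
          using e(2) by (intro continuous_on_subset[OF contD]) auto
        show "(\<lambda>t. P (t, q)) integrable_on cbox 0 1" if "q \<in> ball p e" for q
        proof (rule integrable_continuous)
          have "continuous_on \<Omega> P" using Ck_on_le[OF _ Suc.prems, of 0] by simp
          moreover have "(\<lambda>t. (t, q)) ` cbox 0 1 \<subseteq> \<Omega>" using that e(2) sub by auto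
          ultimately show "continuous_on (cbox 0 1) (\<lambda>t. P (t, q))"
            by (rule continuous_on_compose2[OF _ continuous_on_Pair[OF continuous_on_id continuous_on_const]])
        qed
      qed (use e in auto)
      moreover have "blinfun_apply (integral (cbox 0 1) (\<lambda>t. Blinfun (D p t))) v = integral {0..1} (\<lambda>t. D p t v)" for v
      proof -
        have "continuous_on {0..1} (\<lambda>t. Blinfun (D p t))"
          using continuous_on_compose2[OF contD continuous_on_Pair[OF continuous_on_const[of "{0..1}" p] continuous_on_id]] p
          by auto
        then have "(\<lambda>t. Blinfun (D p t)) integrable_on {0..1}" by (rule integrable_continuous_interval)
        then have "blinfun_apply (integral {0..1} (\<lambda>t. Blinfun (D p t))) v = integral {0..1} (\<lambda>t. blinfun_apply (Blinfun (D p t)) v)"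
          by (rule blinfun_apply_integral)
        also have "\<dots> = integral {0..1} (\<lambda>t. D p t v)"
          using bl[OF p] by (intro integral_cong) auto
        finally show ?thesis by simp
      qed
      then have "blinfun_apply (integral (cbox 0 1) (\<lambda>t. Blinfun (D p t))) = (\<lambda>v. integral {0..1} (\<lambda>t. D p t v))" by blast
      ultimately show "((\<lambda>p. integral {0..1} (\<lambda>t. P (t, p))) has_derivative (\<lambda>v. integral {0..1} (\<lambda>t. D p t v))) (at p)"
        using e by (simp add: at_within_open[OF _ open_ball])
    next
      fix v
      show "Ck_on k (\<lambda>p. integral {0..1} (\<lambda>t. D p t v)) S"
        unfolding D_def using Suc.prems by (intro Suc.IH[of "\<lambda>q. frechet_derivative P (at q) (0, v)"]) simp
    qed
  }
qed

text \<open>The first-order term vanishes on the whole slice \<open>x = a\<close>, so Taylor's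
  formula with integral remainder gives \<open>H (x, y) - H (a, y) = (x - a)^2 h (x, y)\<close> with
  \<open>h\<close> smooth and \<open>h (a, b) = H2 (a, b) / 2\<close> nonzero. The new coordinate is
  \<open>X = (x - a) sqrt (\<eta> h)\<close>.\<close>

lemma morse_with_parameters:
  fixes H :: "real \<times> 'a::euclidean_space \<Rightarrow> real"
  assumes \<Omega>: "open \<Omega>" "(a, b) \<in> \<Omega>" and H: "smooth_on \<Omega> H"
    and crit: "\<And>y. (a, y) \<in> \<Omega> \<Longrightarrow> frechet_derivative H (at (a, y)) (1, 0) = 0"
    and nd: "frechet_derivative (\<lambda>p. frechet_derivative H (at p) (1, 0)) (at (a, b)) (1, 0) \<noteq> 0"
  obtains N X \<eta> c where "open N" "(a, b) \<in> N" "N \<subseteq> \<Omega>" "smooth_on N X" "\<eta> \<in> {-1, 1}" "c \<noteq> 0"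
    "\<And>x y. (x, y) \<in> N \<Longrightarrow> (a, y) \<in> \<Omega> \<and> (X (x, y))\<^sup>2 = \<eta> * (H (x, y) - H (a, y))"
    "X (a, b) = 0" "(X has_derivative (\<lambda>v. c * fst v)) (at (a, b))"
proof -
  define H1 where "H1 p = frechet_derivative H (at p) (1, 0)" for p
  define H2 where "H2 p = frechet_derivative H1 (at p) (1, 0)" for p
  have sH1: "smooth_on \<Omega> H1" unfolding H1_def by (rule smooth_on_frechet_derivative[OF H])
  have sH2: "smooth_on \<Omega> H2" unfolding H2_def by (rule smooth_on_frechet_derivative[OF sH1])
  obtain A B where AB: "open A" "open B" "a \<in> A" "b \<in> B" "A \<times> B \<subseteq> \<Omega>"
    using \<Omega> by (metis open_prod_elim mem_Sigma_iff)
  obtain e where e: "e > 0" "ball a e \<subseteq> A" using AB openE by blast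
  \<comment> \<open>A ball times \<open>B\<close>, so that the segment from \<open>(a, y)\<close> to
    \<open>(x, y)\<close> stays in the domain.\<close>
  define S where "S = ball a e \<times> B"
  have S: "open S" "(a, b) \<in> S" "S \<subseteq> \<Omega>"
    unfolding S_def using AB e by (auto intro: open_Times)
  have seg: "(a + t * (x - a), y) \<in> S" if "(x, y) \<in> S" "t \<in> {0..1}" for x y t
  proof -
    have "\<bar>t * (x - a)\<bar> \<le> \<bar>x - a\<bar>"
      using that(2) by (simp add: abs_mult mult_left_le_one_le)
    then show ?thesis using that(1) unfolding S_def by (auto simp: dist_real_def)
  qed
  \<comment> \<open>\<open>\<gamma>\<close> runs along this segment; the preimage of
    \<open>\<Omega>\<close> is an open set containing \<open>{0..1} \<times> S\<close> on which the
    integrand \<open>P\<close> is smooth.\<close>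
  define \<gamma> where "\<gamma> = (\<lambda>q :: real \<times> real \<times> 'a. (a + fst q * (fst (snd q) - a), snd (snd q)))"
  define \<Omega>' where "\<Omega>' = \<gamma> -` \<Omega>"
  define P where "P q = (1 - fst q) * H2 (\<gamma> q)" for q
  define h where "h p = integral {0..1} (\<lambda>t. P (t, p))" for p
  have "continuous_on UNIV \<gamma>" unfolding \<gamma>_def by (intro continuous_intros)
  then have \<Omega>': "open \<Omega>'" unfolding \<Omega>'_def using \<Omega>(1) open_vimage by blast
  have s\<gamma>: "smooth_on \<Omega>' \<gamma>" unfolding \<gamma>_def by (intro smooth_intros \<Omega>')
  have "smooth_on \<Omega>' P" unfolding P_def
    by (intro smooth_on_mult smooth_on_diff smooth_on_fst smooth_on_const smooth_on_ident
        smooth_on_compose[OF sH2 \<Omega>' \<Omega>(1) _ s\<gamma>] \<Omega>') (simp add: \<Omega>'_def)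
  moreover have "{0..1} \<times> S \<subseteq> \<Omega>'"
    using subsetD[OF S(3) seg] unfolding \<Omega>'_def \<gamma>_def by auto
  ultimately have sh: "smooth_on S h"
    using Ck_on_integral_param[OF \<Omega>' S(1)] unfolding smooth_on_def h_def by blast
  have taylor: "H (x, y) - H (a, y) = (x - a)\<^sup>2 * h (x, y)" if xy: "(x, y) \<in> S" for x y
  proof -
    define d where "d = x - a"
    \<comment> \<open>The derivative of \<open>G\<close> telescopes to
      \<open>(1 - t) d^2 H2\<close>, and \<open>G 1 - G 0\<close> is the increment of
      \<open>H\<close> minus \<open>d * H1 (a, y)\<close>, which is 0 by
      \<open>crit\<close>.\<close>
    define G where "G t = (1 - t) * d * H1 (a + t * d, y) + H (a + t * d, y)" for t
    have line: "((\<lambda>t. (a + t * d, y)) has_derivative (\<lambda>s. s *\<^sub>R (d *\<^sub>R (1, 0)))) (at t within {0..1})" for t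
      by (auto intro!: derivative_eq_intros simp: scaleR_prod_def)
    have der: "((\<lambda>t. f (a + t * d, y)) has_vector_derivative d * frechet_derivative f (at (a + t * d, y)) (1, 0)) (at t within {0..1})"
      if "smooth_on \<Omega> f" "t \<in> {0..1}" for f :: "real \<times> 'a \<Rightarrow> real" and t
    proof -
      have "(a + t * d, y) \<in> \<Omega>" using seg[OF xy that(2)] S(3) unfolding d_def by auto
      note f = smooth_on_has_derivative[OF that(1) this]
      from has_derivative_linear[OF f] have lin: "linear (frechet_derivative f (at (a + t * d, y)))" .
      show ?thesis
        using has_derivative_compose[OF line f]
        by (simp add: has_vector_derivative_def linear_scale[OF lin] mult.assoc flip: scaleR_conv_of_real del: scaleR_Pair)
    qed
    have "(G has_vector_derivative d\<^sup>2 * P (t, x, y)) (at t within {0..1})" if "t \<in> {0..1}" for t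
      unfolding G_def P_def \<gamma>_def using der[OF H that] der[OF sH1 that]
      by (auto intro!: derivative_eq_intros simp: H1_def[symmetric] H2_def[symmetric] d_def algebra_simps power2_eq_square
          simp flip: has_real_derivative_iff_has_vector_derivative)
    then have "((\<lambda>t. d\<^sup>2 * P (t, x, y)) has_integral G 1 - G 0) {0..1}"
      by (intro fundamental_theorem_of_calculus) auto
    then have "G 1 - G 0 = d\<^sup>2 * h (x, y)"
      unfolding h_def by (metis integral_mult_right integral_unique)
    moreover have "(a, y) \<in> \<Omega>" using seg[OF xy, of 0] S(3) by auto
    then have "G 1 - G 0 = H (x, y) - H (a, y)"
      unfolding G_def d_def using crit by (simp add: H1_def)
    ultimately show ?thesis by (simp add: d_def)
  qed
  have "integral {0..1} (\<lambda>t::real. (1 - t) * H2 (a, b)) = H2 (a, b) / 2"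
  proof -
    have "((\<lambda>t::real. (1 - t) * H2 (a, b)) has_integral (1 - 1\<^sup>2 / 2) * H2 (a, b) - (0 - 0\<^sup>2 / 2) * H2 (a, b)) {0..1}"
      by (rule fundamental_theorem_of_calculus)
        (auto intro!: derivative_eq_intros simp flip: has_real_derivative_iff_has_vector_derivative)
    from integral_unique[OF this] show ?thesis by (simp del: integral_mult_left)
  qed
  then have hab: "h (a, b) \<noteq> 0"
    using nd by (simp add: h_def P_def \<gamma>_def H2_def H1_def[abs_def])
  \<comment> \<open>The sign makes the radicand positive at \<open>(a, b)\<close>; \<open>N\<close>
    is the part of \<open>S\<close> where it is positive.\<close>
  define \<eta> where "\<eta> = sgn (h (a, b))"
  define N where "N = S \<inter> (\<lambda>p. \<eta> * h p) -` {0<..}"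
  define X where "X p = (fst p - a) * sqrt (\<eta> * h p)" for p
  have N: "open N" unfolding N_def
    using smooth_on_imp_continuous_on[OF sh] S(1)
    by (intro continuous_open_preimage continuous_intros) auto
  have pos: "\<eta> * h (a, b) > 0" using hab unfolding \<eta>_def by (simp add: sgn_if)
  have "smooth_on N (\<lambda>p. sqrt (\<eta> * h p))"
    using smooth_on_subset[OF sh, of N] unfolding N_def[symmetric]
    by (intro smooth_on_sqrt smooth_on_mult smooth_on_const N) (auto simp: N_def)
  then have sX: "smooth_on N X" unfolding X_def
    by (intro smooth_on_mult smooth_on_diff smooth_on_fst smooth_on_ident smooth_on_const N)
  have sq: "(X (x, y))\<^sup>2 = \<eta> * (H (x, y) - H (a, y))" "(a, y) \<in> \<Omega>" if "(x, y) \<in> N" for x y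
    using that taylor[of x y] seg[of x y 0] S(3) by (auto simp: X_def N_def power_mult_distrib)
  \<comment> \<open>The factor \<open>x - a\<close> vanishes at the base point, so only its own
    derivative survives in the product rule.\<close>
  have dX: "(X has_derivative (\<lambda>v. sqrt (\<eta> * h (a, b)) * fst v)) (at (a, b))"
  proof -
    have s: "((\<lambda>p. sqrt (\<eta> * h p)) has_derivative frechet_derivative (\<lambda>p. sqrt (\<eta> * h p)) (at (a, b))) (at (a, b))"
      using smooth_on_has_derivative[OF \<open>smooth_on N (\<lambda>p. sqrt (\<eta> * h p))\<close>] pos S(2) by (simp add: N_def)
    show ?thesis unfolding X_def
      by (rule has_derivative_eq_rhs, rule has_derivative_mult[OF _ s]) (auto intro!: derivative_eq_intros)
  qed
  show ?thesis
  proof (rule that)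
    show "\<eta> \<in> {-1, 1}" using hab by (simp add: \<eta>_def sgn_if)
    show "sqrt (\<eta> * h (a, b)) \<noteq> 0" using pos by auto
    show "(a, b) \<in> N" "N \<subseteq> \<Omega>" "X (a, b) = 0" using S pos by (auto simp: N_def X_def)
  qed (use N sX sq dX in auto)
qed

section \<open>The Hamiltonian vector field\<close>

lemma matrix2_mult_nth: "((A :: real^2^2) ** B) $ i $ j = A $ i $ 1 * B $ 1 $ j + A $ i $ 2 * B $ 2 $ j"
  by (simp add: matrix_matrix_mult_def sum_2)

lemma matrix2_eq_iff:
  "(A :: real^2^2) = B \<longleftrightarrow> A $ 1 $ 1 = B $ 1 $ 1 \<and> A $ 1 $ 2 = B $ 1 $ 2 \<and> A $ 2 $ 1 = B $ 2 $ 1 \<and> A $ 2 $ 2 = B $ 2 $ 2"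
  by (auto simp: vec_eq_iff forall_2)

lemma vec3_eq_iff: "(a :: real^3) = b \<longleftrightarrow> a $ 1 = b $ 1 \<and> a $ 2 = b $ 2 \<and> a $ 3 = b $ 3"
  by (auto simp: vec_eq_iff forall_3)

lemma inner_matrix2:
  "(A :: real^2^2) \<bullet> B = A $ 1 $ 1 * B $ 1 $ 1 + A $ 1 $ 2 * B $ 1 $ 2 + A $ 2 $ 1 * B $ 2 $ 1 + A $ 2 $ 2 * B $ 2 $ 2"
  by (simp add: inner_vec_def sum_2)

lemma bounded_bilinear_matrix2_mult: "bounded_bilinear ((**) :: real^2^2 \<Rightarrow> real^2^2 \<Rightarrow> real^2^2)"
  unfolding bilinear_conv_bounded_bilinear[symmetric] bilinear_def
  by (auto intro!: linearI simp: matrix2_eq_iff matrix2_mult_nth algebra_simps)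

text \<open>The adjugate: it equals the inverse on \<open>SL2\<close> and is linear, hence easy to
  differentiate in the ambient space.\<close>

definition adj2 :: "real^2^2 \<Rightarrow> real^2^2" where
  "adj2 Q = vector [vector [Q $ 2 $ 2, - Q $ 1 $ 2], vector [- Q $ 2 $ 1, Q $ 1 $ 1]]"

lemma adj2_nth [simp]:
  "adj2 Q $ 1 $ 1 = Q $ 2 $ 2" "adj2 Q $ 1 $ 2 = - Q $ 1 $ 2"
  "adj2 Q $ 2 $ 1 = - Q $ 2 $ 1" "adj2 Q $ 2 $ 2 = Q $ 1 $ 1"
  by (simp_all add: adj2_def)

lemma bounded_linear_adj2: "bounded_linear adj2"
  unfolding linear_conv_bounded_linear[symmetric]
  by (auto intro!: linearI simp: matrix2_eq_iff)

lemma adj2_mult: "adj2 (A ** B) = adj2 B ** adj2 A"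
  by (simp add: matrix2_eq_iff matrix2_mult_nth)

lemma adj2_right: "A ** adj2 A = det A *\<^sub>R mat 1"
  by (simp add: matrix2_eq_iff matrix2_mult_nth det_2 mat_def)

lemma adj2_left: "adj2 A ** A = det A *\<^sub>R mat 1"
  by (simp add: matrix2_eq_iff matrix2_mult_nth det_2 mat_def)

lemma matrix_inv_left2:
  fixes Q :: "real^2^2"
  assumes "det Q \<noteq> 0" shows "matrix_inv Q ** Q = mat 1"
  using assms unfolding invertible_det_nz[symmetric] invertible_def matrix_inv_def
  by (rule someI2_ex) blast

lemma matrix_inv_eq_adj2:
  fixes Q :: "real^2^2"
  assumes "det Q \<noteq> 0" shows "matrix_inv Q = (1 / det Q) *\<^sub>R adj2 Q"
proof -
  have "Q ** ((1 / det Q) *\<^sub>R adj2 Q) = mat 1"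
    using assms adj2_right[of Q] by (simp add: bounded_bilinear.scaleR_right[OF bounded_bilinear_matrix2_mult])
  then show ?thesis using matrix_inv_left2[OF assms] by (metis matrix_mul_assoc matrix_mul_lid matrix_mul_rid)
qed

text \<open>This is \<open>covector_vec\<close> at the identity; coordinates come in the order
  \<open>X1\<close>, \<open>X2\<close>, \<open>X0\<close>.\<close>

definition hat :: "real^3 \<Rightarrow> real^2^2" where
  "hat l = (l$1) *\<^sub>R X1 + (l$2) *\<^sub>R X2 + (l$3) *\<^sub>R X0"

lemma hat_nth [simp]:
  "hat l $ 1 $ 1 = l $ 1 / 2" "hat l $ 1 $ 2 = (l $ 2 - l $ 3) / 2"
  "hat l $ 2 $ 1 = (l $ 2 + l $ 3) / 2" "hat l $ 2 $ 2 = - l $ 1 / 2"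
  by (simp_all add: hat_def X0_def X1_def X2_def field_simps)

lemma hat_inner: "2 * (hat a \<bullet> hat b) = a \<bullet> b"
  by (simp add: inner_matrix2 inner_vec_def sum_3 field_simps)

text \<open>The brackets \<open>[X2, X0] = X1\<close>, \<open>[X0, X1] = X2\<close> and
  \<open>[X1, X2] = - X0\<close>; the last one causes the minus sign by which the right-hand side
  differs from a triple product.\<close>

lemma hat_commutator:
  "2 * (hat l \<bullet> (hat a ** hat b - hat b ** hat a)) =
   l$1 * (a$2 * b$3 - a$3 * b$2) + l$2 * (a$3 * b$1 - a$1 * b$3) - l$3 * (a$1 * b$2 - a$2 * b$1)"
  by (simp add: inner_matrix2 matrix2_mult_nth field_simps)

lemma adj2_hat: "adj2 (hat l) = - hat l"
  by (simp add: matrix2_eq_iff)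

lemma sl2_eq: "sl2 = range hat"
proof -
  have "\<xi> = hat (vector [2 * \<xi>$1$1, \<xi>$1$2 + \<xi>$2$1, \<xi>$2$1 - \<xi>$1$2])" if "trace \<xi> = 0" for \<xi>
    using that by (simp add: matrix2_eq_iff trace_def sum_2)
  moreover have "trace (hat l) = 0" for l by (simp add: trace_def sum_2)
  ultimately show ?thesis unfolding sl2_def by blast
qed

lemma covector_vec_eq: "covector_vec q l = q ** hat l"
  by (simp add: covector_vec_def left_inv_field_def hat_def matrix2_eq_iff matrix2_mult_nth algebra_simps)

text \<open>The formula covers all invertible base points, because the form is differentiated in the
  ambient space and not only along \<open>SL2\<close>.\<close>

lemma liouville_form_eq:
  assumes "det (fst p) \<noteq> 0"
  shows "liouville_form p W = 2 * (hat (snd p) \<bullet> (adj2 (fst p) ** fst W)) / det (fst p)"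
proof -
  have "matrix_inv (fst p) ** (fst p ** hat (snd p)) = hat (snd p)"
    using assms by (simp add: matrix_mul_assoc matrix_inv_left2)
  then show ?thesis
    unfolding liouville_form_def covector_apply_def left_inv_metric_def covector_vec_eq
    using assms by (simp add: matrix_inv_eq_adj2 bounded_bilinear.scaleR_left[OF bounded_bilinear_matrix2_mult])
qed

lemma has_derivative_det2:
  "((det :: real^2^2 \<Rightarrow> real) has_derivative (\<lambda>B. trace (adj2 Q ** B))) (at Q)"
proof -
  have e: "((\<lambda>A :: real^2^2. A $ i $ j) has_derivative (\<lambda>B. B $ i $ j)) (at Q)" for i j
    by (intro bounded_linear.has_derivative[OF bounded_linear_vec_nth] has_derivative_ident)
  have "((\<lambda>A :: real^2^2. A$1$1 * A$2$2 - A$1$2 * A$2$1) has_derivative (\<lambda>B. trace (adj2 Q ** B))) (at Q)"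
    by (rule has_derivative_eq_rhs, rule has_derivative_diff[OF has_derivative_mult[OF e e] has_derivative_mult[OF e e]])
      (auto simp: fun_eq_iff trace_def sum_2 matrix2_mult_nth)
  then show ?thesis by (simp add: det_2[abs_def])
qed

lemma bounded_bilinear_hat_adj2:
  "bounded_bilinear (\<lambda>l Q. hat l \<bullet> (adj2 Q ** A))"
  unfolding bilinear_conv_bounded_bilinear[symmetric] bilinear_def
  by (auto intro!: linearI simp: inner_matrix2 matrix2_mult_nth algebra_simps add_divide_distrib diff_divide_distrib)

text \<open>Product rule for \<open>liouville_form_eq\<close>; the last term comes from
  \<open>1 / det\<close> and vanishes in directions tangent to \<open>SL2\<close>.\<close>

lemma has_derivative_liouville_form:
  assumes "det Q = 1"
  shows "((\<lambda>p. liouville_form p W) has_derivative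
    (\<lambda>V. 2 * (hat (snd V) \<bullet> (adj2 Q ** fst W)) + 2 * (hat L \<bullet> (adj2 (fst V) ** fst W))
       - 2 * (hat L \<bullet> (adj2 Q ** fst W)) * trace (adj2 Q ** fst V))) (at (Q, L))"
proof -
  have d: "((\<lambda>p :: phase. det (fst p)) has_derivative (\<lambda>V. trace (adj2 Q ** fst V))) (at (Q, L))"
  proof -
    have "(fst has_derivative fst) (at (Q, L))"
      by (rule has_derivative_fst[OF has_derivative_ident])
    from has_derivative_compose[OF this, unfolded fst_conv, OF has_derivative_det2] show ?thesis .
  qed
  have b: "((\<lambda>p :: phase. hat (snd p) \<bullet> (adj2 (fst p) ** fst W)) has_derivative
      (\<lambda>V. hat L \<bullet> (adj2 (fst V) ** fst W) + hat (snd V) \<bullet> (adj2 Q ** fst W))) (at (Q, L))"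
    by (rule has_derivative_eq_rhs, rule bounded_bilinear.FDERIV[OF bounded_bilinear_hat_adj2[of "fst W"]
        has_derivative_snd[OF has_derivative_ident] has_derivative_fst[OF has_derivative_ident]]) simp
  have "((\<lambda>p :: phase. 2 * (hat (snd p) \<bullet> (adj2 (fst p) ** fst W)) / det (fst p)) has_derivative
    (\<lambda>V. 2 * (hat (snd V) \<bullet> (adj2 Q ** fst W)) + 2 * (hat L \<bullet> (adj2 (fst V) ** fst W))
       - 2 * (hat L \<bullet> (adj2 Q ** fst W)) * trace (adj2 Q ** fst V))) (at (Q, L))"
    by (rule has_derivative_eq_rhs, rule has_derivative_divide'[OF has_derivative_mult_right[OF b] d])
      (simp_all add: assms fun_eq_iff algebra_simps)
  moreover have "open {p :: phase. det (fst p) \<noteq> 0}"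
    unfolding det_2 by (intro open_Collect_neq continuous_intros)
  ultimately show ?thesis
    by (rule has_derivative_transform_within_open) (auto simp: assms liouville_form_eq)
qed

text \<open>Cartan's formula in the left trivialisation: the pairing of fibre and base directions
  minus the covector evaluated on \<open>[a, b]\<close>. The bracket arises from differentiating the
  adjugate, since \<open>adj2 (hat a) = - hat a\<close>.\<close>

lemma symplectic_form_left_inv:
  assumes "det Q = 1"
  shows "symplectic_form (Q, L) (Q ** hat a, m) (Q ** hat b, n) =
    m \<bullet> b - n \<bullet> a - 2 * (hat L \<bullet> (hat a ** hat b - hat b ** hat a))"
proof -
  have "frechet_derivative (\<lambda>p. liouville_form p (Q ** hat b, n)) (at (Q, L)) (Q ** hat a, m) =
        m \<bullet> b - 2 * (hat L \<bullet> (hat a ** hat b))" for a b m n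
  proof -
    have 1: "adj2 Q ** (Q ** hat c) = hat c" for c
      using assms by (simp add: matrix_mul_assoc adj2_left)
    have "adj2 (Q ** hat a) ** (Q ** hat b) = - hat a ** (adj2 Q ** (Q ** hat b))"
      by (simp add: adj2_mult adj2_hat matrix_mul_assoc)
    then have 2: "adj2 (Q ** hat a) ** (Q ** hat b) = - (hat a ** hat b)"
      unfolding 1 by (simp add: matrix2_eq_iff matrix2_mult_nth)
    have 3: "trace (hat a) = 0" by (simp add: trace_def sum_2)
    show ?thesis
      unfolding frechet_derivative_at[OF has_derivative_liouville_form[OF assms], symmetric]
      by (simp add: 1 2 3 hat_inner)
  qed
  then show ?thesis by (simp add: symplectic_form_def inner_diff_right)
qed

lemma frechet_derivative_sr_hamiltonian:
  "frechet_derivative sr_hamiltonian (at (Q, L)) W = L$1 * snd W $ 1 + L$2 * snd W $ 2"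
proof -
  have "((\<lambda>p :: phase. snd p $ i) has_derivative (\<lambda>W. snd W $ i)) (at (Q, L))" for i
    by (intro bounded_linear.has_derivative[OF bounded_linear_vec_nth] has_derivative_snd has_derivative_ident)
  note d = this[of 1] this[of 2]
  have "(sr_hamiltonian has_derivative (\<lambda>W. L$1 * snd W $ 1 + L$2 * snd W $ 2)) (at (Q, L))"
    unfolding sr_hamiltonian_def[abs_def]
    by (auto intro!: derivative_eq_intros d simp: fun_eq_iff)
  from fun_cong[OF frechet_derivative_at[OF this], of W] show ?thesis by simp
qed

text \<open>An equivalence, because the \<open>THE\<close> in \<open>hamiltonian_field\<close>
  requires both existence and uniqueness.\<close>

lemma is_hamiltonian_vector_sr_iff:
  assumes "det Q = 1"
  shows "is_hamiltonian_vector sr_hamiltonian (Q, L) V \<longleftrightarrow>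
    V = (Q ** hat (vector [L$1, L$2, 0]), vector [L$3 * L$2, - (L$3 * L$1), 0])" (is "_ \<longleftrightarrow> V = ?V")
proof -
  have tc: "tangent_cotangent (Q, L) = {(Q ** hat a, m) | a m. True}"
    by (auto simp: tangent_cotangent_def tangent_SL2_def sl2_eq left_inv_field_def)
  have iff: "is_hamiltonian_vector sr_hamiltonian (Q, L) (Q ** hat b, n) \<longleftrightarrow>
     (\<forall>a m. m \<bullet> b - n \<bullet> a - 2 * (hat L \<bullet> (hat a ** hat b - hat b ** hat a)) = L$1 * m $ 1 + L$2 * m $ 2)" for b n
  proof -
    have "is_hamiltonian_vector sr_hamiltonian (Q, L) (Q ** hat b, n) \<longleftrightarrow>
      (\<forall>a m. symplectic_form (Q, L) (Q ** hat a, m) (Q ** hat b, n) = L$1 * m $ 1 + L$2 * m $ 2)"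
      unfolding is_hamiltonian_vector_def tc by (auto simp: frechet_derivative_sr_hamiltonian)
    then show ?thesis unfolding symplectic_form_left_inv[OF assms] .
  qed
  show ?thesis
  proof
    assume V: "is_hamiltonian_vector sr_hamiltonian (Q, L) V"
    then obtain b n where bn: "V = (Q ** hat b, n)" unfolding is_hamiltonian_vector_def tc by blast
    have *: "m \<bullet> b - n \<bullet> a - 2 * (hat L \<bullet> (hat a ** hat b - hat b ** hat a)) = L$1 * m $ 1 + L$2 * m $ 2" for a m
      using V iff unfolding bn by blast
    \<comment> \<open>Vertical test vectors (\<open>a = 0\<close>) read off
      \<open>b\<close>.\<close>
    have b: "b = vector [L$1, L$2, 0]"
      using *[of "axis 1 1" 0] *[of "axis 2 1" 0] *[of "axis 3 1" 0]
      unfolding hat_commutator by (simp add: vec3_eq_iff inner_vec_def sum_3 axis_def)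
    \<comment> \<open>Horizontal test vectors (\<open>m = 0\<close>) then read off \<open>n\<close>
      through the bracket with \<open>b\<close>.\<close>
    have "n = vector [L$3 * L$2, - (L$3 * L$1), 0]"
      using *[of 0 "axis 1 1"] *[of 0 "axis 2 1"] *[of 0 "axis 3 1"]
      unfolding hat_commutator b by (simp add: vec3_eq_iff inner_vec_def sum_3 axis_def)
    then show "V = ?V" using bn b by simp
  next
    assume "V = ?V"
    show "is_hamiltonian_vector sr_hamiltonian (Q, L) V"
      unfolding \<open>V = ?V\<close> iff hat_commutator by (simp add: inner_vec_def sum_3 algebra_simps)
  qed
qed

lemma hamiltonian_field_sr:
  assumes "det Q = 1"
  shows "hamiltonian_field sr_hamiltonian (Q, L) =
    (Q ** hat (vector [L$1, L$2, 0]), vector [L$3 * L$2, - (L$3 * L$1), 0])"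
  unfolding hamiltonian_field_def is_hamiltonian_vector_sr_iff[OF assms] by simp

section \<open>The Hamiltonian flow\<close>

lemma has_vector_derivative_vec:
  fixes f :: "real \<Rightarrow> 'a::euclidean_space^'n"
  assumes "\<And>i. ((\<lambda>t. f t $ i) has_vector_derivative f' $ i) F"
  shows "(f has_vector_derivative f') F"
proof -
  have eq: "x = (\<Sum>i\<in>UNIV. axis i (x $ i))" for x :: "'a^'n"
    by (simp add: vec_eq_iff axis_def if_distrib cong: if_cong)
  have "((\<lambda>t. \<Sum>i\<in>UNIV. axis i (f t $ i)) has_vector_derivative (\<Sum>i\<in>UNIV. axis i (f' $ i))) F"
    using assms by (intro has_vector_derivative_sum bounded_linear.has_vector_derivative[OF bounded_linear_axis])
  then show ?thesis by (simp add: eq[symmetric])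
qed

lemma has_vector_derivative_zero_imp_eq:
  fixes f :: "real \<Rightarrow> 'a::real_normed_vector"
  assumes "\<And>t. (f has_vector_derivative 0) (at t)"
  shows "f s = f t"
proof -
  obtain c where "\<And>x. x \<in> UNIV \<Longrightarrow> f x = c"
    using has_vector_derivative_zero_constant[of UNIV f] assms by auto
  then show ?thesis by simp
qed

definition sr_field :: "phase \<Rightarrow> phase" where
  "sr_field p = (fst p ** hat (vector [snd p $ 1, snd p $ 2, 0]),
     vector [snd p $ 3 * snd p $ 2, - (snd p $ 3 * snd p $ 1), 0])"

lemma is_hamiltonian_trajectory_sr_iff:
  "is_hamiltonian_trajectory sr_hamiltonian \<gamma> \<longleftrightarrow>
    (\<forall>t. det (fst (\<gamma> t)) = 1 \<and> (\<gamma> has_vector_derivative sr_field (\<gamma> t)) (at t))"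
proof -
  have "hamiltonian_field sr_hamiltonian p = sr_field p" if "det (fst p) = 1" for p
    using hamiltonian_field_sr[OF that, of "snd p"] by (simp add: sr_field_def)
  then show ?thesis
    by (simp add: is_hamiltonian_trajectory_def cotangent_bundle_def SL2_def mem_Times_iff cong: conj_cong)
qed

text \<open>Conserved quantities replace a Lipschitz argument. The third covector coordinate is
  constant; the differences of the first two then solve a rotation equation, so their squared norm
  \<open>N\<close> stays 0. Finally one base curve times the inverse of the other is constant, as
  both solve the same linear equation.\<close>

lemma sr_trajectory_unique:
  assumes "\<And>t. det (fst (\<gamma> t)) = 1" "\<And>t. (\<gamma> has_vector_derivative sr_field (\<gamma> t)) (at t)"
    and "\<And>t. det (fst (\<delta> t)) = 1" "\<And>t. (\<delta> has_vector_derivative sr_field (\<delta> t)) (at t)"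
    and init: "\<gamma> 0 = \<delta> 0"
  shows "\<gamma> = \<delta>"
proof
  fix t
  have comp: "((\<lambda>t. snd (\<epsilon> t) $ i) has_vector_derivative snd (sr_field (\<epsilon> t)) $ i) (at t)"
    if "\<And>t. (\<epsilon> has_vector_derivative sr_field (\<epsilon> t)) (at t)" for \<epsilon> i t
    using that by (intro bounded_linear.has_vector_derivative[OF bounded_linear_vec_nth]
        bounded_linear.has_vector_derivative[OF bounded_linear_snd])
  note \<gamma>' = comp[OF assms(2), folded has_real_derivative_iff_has_vector_derivative]
    and \<delta>' = comp[OF assms(4), folded has_real_derivative_iff_has_vector_derivative]
  have "snd (\<epsilon> t) $ 3 = snd (\<epsilon> 0) $ 3"
    if "\<And>t. (\<epsilon> has_vector_derivative sr_field (\<epsilon> t)) (at t)" for \<epsilon> t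
    by (rule has_vector_derivative_zero_imp_eq) (use comp[OF that, of 3] in \<open>simp add: sr_field_def\<close>)
  then obtain w where L3: "\<And>t. snd (\<gamma> t) $ 3 = w" "\<And>t. snd (\<delta> t) $ 3 = w"
    using assms(2,4) init by metis
  define N where "N t = (snd (\<gamma> t) $ 1 - snd (\<delta> t) $ 1)\<^sup>2 + (snd (\<gamma> t) $ 2 - snd (\<delta> t) $ 2)\<^sup>2" for t
  have "(N has_vector_derivative 0) (at t)" for t
    unfolding N_def[abs_def] has_real_derivative_iff_has_vector_derivative[symmetric]
    by (rule DERIV_cong, rule DERIV_add[OF DERIV_power[OF DERIV_diff[OF \<gamma>'[of 1 t] \<delta>'[of 1 t]]]
          DERIV_power[OF DERIV_diff[OF \<gamma>'[of 2 t] \<delta>'[of 2 t]]]])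
      (simp add: sr_field_def L3 algebra_simps)
  then have "N t = N 0" for t by (rule has_vector_derivative_zero_imp_eq)
  then have "N t = 0" for t by (simp add: N_def init)
  then have L: "snd (\<gamma> t) = snd (\<delta> t)" for t
    unfolding N_def by (simp add: vec3_eq_iff L3 sum_power2_eq_zero_iff)
  have Q': "((\<lambda>t. fst (\<epsilon> t)) has_vector_derivative fst (\<epsilon> t) ** hat (vector [snd (\<epsilon> t) $ 1, snd (\<epsilon> t) $ 2, 0])) (at t)"
    if "\<And>t. (\<epsilon> has_vector_derivative sr_field (\<epsilon> t)) (at t)" for \<epsilon> t
    using bounded_linear.has_vector_derivative[OF bounded_linear_fst that[of t]] by (simp add: sr_field_def)
  have "((\<lambda>t. fst (\<gamma> t) ** adj2 (fst (\<delta> t))) has_vector_derivative 0) (at t)" for t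
  proof -
    let ?A = "hat (vector [snd (\<delta> t) $ 1, snd (\<delta> t) $ 2, 0])"
    \<comment> \<open>Differentiating the adjugate of the second curve produces \<open>- ?A\<close>,
      which cancels the \<open>?A\<close> coming from the first.\<close>
    have "fst (\<gamma> t) ** (adj2 ?A ** adj2 (fst (\<delta> t))) + fst (\<gamma> t) ** ?A ** adj2 (fst (\<delta> t)) = 0"
      unfolding adj2_hat by (simp add: matrix2_eq_iff matrix2_mult_nth algebra_simps)
    then show ?thesis
      using bounded_bilinear.has_vector_derivative[OF bounded_bilinear_matrix2_mult Q'[OF assms(2), of t]
          bounded_linear.has_vector_derivative[OF bounded_linear_adj2 Q'[OF assms(4), of t]]]
      unfolding adj2_mult L by simp
  qed
  then have "fst (\<gamma> t) ** adj2 (fst (\<delta> t)) = fst (\<gamma> 0) ** adj2 (fst (\<delta> 0))"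
    by (rule has_vector_derivative_zero_imp_eq)
  also have "\<dots> = mat 1" by (simp add: init adj2_right assms(3))
  finally have "fst (\<gamma> t) ** (adj2 (fst (\<delta> t)) ** fst (\<delta> t)) = fst (\<delta> t)"
    by (simp add: matrix_mul_assoc)
  then have "fst (\<gamma> t) = fst (\<delta> t)" by (simp add: adj2_left assms(3))
  with L show "\<gamma> t = \<delta> t" by (simp add: prod_eq_iff)
qed

text \<open>In an elliptic direction (\<open>r > 0\<close>) the matrix \<open>M = u X1 + v X2 - w X0\<close> satisfies
  \<open>M\<^sup>2 = - r/4\<close>, so the one-parameter groups of \<open>M\<close> and \<open>X0\<close> are trigonometric.\<close>

definition ell_exp :: "real^3 \<Rightarrow> real \<Rightarrow> real^2^2" where
  "ell_exp l t = cos (sqrt (cov_r l) * t / 2) *\<^sub>R mat 1 +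
     (2 * sin (sqrt (cov_r l) * t / 2) / sqrt (cov_r l)) *\<^sub>R hat (vector [l$1, l$2, - l$3])"

text \<open>This is \<open>exp (\<theta> X0)\<close>; the half angle comes from the factor
  \<open>1/2\<close> in \<open>X0\<close>.\<close>

definition rot2 :: "real \<Rightarrow> real^2^2" where
  "rot2 \<theta> = vector [vector [cos (\<theta> / 2), - sin (\<theta> / 2)], vector [sin (\<theta> / 2), cos (\<theta> / 2)]]"

definition ell_flow :: "real^2^2 \<Rightarrow> real^3 \<Rightarrow> real \<Rightarrow> phase" where
  "ell_flow q l t = (q ** (ell_exp l t ** rot2 (l$3 * t)),
     vector [l$1 * cos (l$3 * t) + l$2 * sin (l$3 * t), l$2 * cos (l$3 * t) - l$1 * sin (l$3 * t), l$3])"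

lemma rot2_nth [simp]:
  "rot2 \<theta> $ 1 $ 1 = cos (\<theta> / 2)" "rot2 \<theta> $ 1 $ 2 = - sin (\<theta> / 2)"
  "rot2 \<theta> $ 2 $ 1 = sin (\<theta> / 2)" "rot2 \<theta> $ 2 $ 2 = cos (\<theta> / 2)"
  by (simp_all add: rot2_def)

lemma ell_exp_nth:
  fixes l :: "real^3"
  defines "c \<equiv> \<lambda>t. cos (sqrt (cov_r l) * t / 2)" and "s \<equiv> \<lambda>t. sin (sqrt (cov_r l) * t / 2) / sqrt (cov_r l)"
  shows "ell_exp l t $ 1 $ 1 = c t + s t * l$1" "ell_exp l t $ 1 $ 2 = s t * (l$2 + l$3)"
    "ell_exp l t $ 2 $ 1 = s t * (l$2 - l$3)" "ell_exp l t $ 2 $ 2 = c t - s t * l$1"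
  by (simp_all add: ell_exp_def c_def s_def mat_def)

lemma has_vector_derivative_ell_exp:
  assumes "cov_r l > 0"
  shows "(ell_exp l has_vector_derivative ell_exp l t ** hat (vector [l$1, l$2, - l$3])) (at t)"
proof -
  define \<rho> where "\<rho> = sqrt (cov_r l)"
  have \<rho>: "\<rho> > 0" "\<rho> * \<rho> = (l$3)\<^sup>2 - (l$1)\<^sup>2 - (l$2)\<^sup>2"
    using assms unfolding \<rho>_def by (simp_all add: cov_r_def)
  define c where "c t = cos (\<rho> * t / 2)" for t
  define s where "s t = sin (\<rho> * t / 2) / \<rho>" for t
  have c': "(c has_vector_derivative - (\<rho> * \<rho>) / 2 * s t) (at t)" 
    unfolding c_def s_def has_real_derivative_iff_has_vector_derivative[symmetric] using \<rho>(1)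
    by (auto intro!: derivative_eq_intros)
  have s': "(s has_vector_derivative c t / 2) (at t)" 
    unfolding c_def s_def has_real_derivative_iff_has_vector_derivative[symmetric] using \<rho>(1)
    by (auto intro!: derivative_eq_intros)
  have E: "ell_exp l = (\<lambda>t. c t *\<^sub>R mat 1 + (2 * s t) *\<^sub>R hat (vector [l$1, l$2, - l$3]))"
    by (simp add: ell_exp_def c_def s_def \<rho>_def fun_eq_iff)
  have "(ell_exp l has_vector_derivative
      (- (\<rho> * \<rho>) / 2 * s t) *\<^sub>R mat 1 + (2 * (c t / 2)) *\<^sub>R hat (vector [l$1, l$2, - l$3])) (at t)"
    unfolding E using c' s'
    by (intro has_vector_derivative_add bounded_linear.has_vector_derivative[OF bounded_linear_scaleR_left]
        has_vector_derivative_mult_right) 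
  moreover have "(- (\<rho> * \<rho>) / 2 * s t) *\<^sub>R mat 1 + (2 * (c t / 2)) *\<^sub>R hat (vector [l$1, l$2, - l$3])
      = ell_exp l t ** hat (vector [l$1, l$2, - l$3])"
    unfolding E \<rho>(2)
    by (simp add: matrix2_eq_iff matrix2_mult_nth mat_def field_simps power2_eq_square)
  ultimately show ?thesis by simp
qed


lemma has_vector_derivative_rot2:
  "((\<lambda>t. rot2 (w * t)) has_vector_derivative rot2 (w * t) ** hat (vector [0, 0, w])) (at t)"
proof (rule has_vector_derivative_vec)
  fix i :: 2
  show "((\<lambda>t. rot2 (w * t) $ i) has_vector_derivative (rot2 (w * t) ** hat (vector [0, 0, w])) $ i) (at t)"
  proof (rule has_vector_derivative_vec)
    fix j :: 2
    show "((\<lambda>t. rot2 (w * t) $ i $ j) has_vector_derivative (rot2 (w * t) ** hat (vector [0, 0, w])) $ i $ j) (at t)"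
      using exhaust_2[of i] exhaust_2[of j]
      by (elim disjE) (auto simp: matrix2_mult_nth simp flip: has_real_derivative_iff_has_vector_derivative
          intro!: derivative_eq_intros)
  qed
qed

lemma det_ell_exp:
  assumes "cov_r l > 0" shows "det (ell_exp l t) = 1"
proof -
  define \<rho> where "\<rho> = sqrt (cov_r l)"
  have \<rho>: "\<rho> \<noteq> 0" "\<rho>\<^sup>2 = (l$3)\<^sup>2 - (l$1)\<^sup>2 - (l$2)\<^sup>2"
    using assms unfolding \<rho>_def by (simp_all add: cov_r_def)
  have "det (ell_exp l t) = (cos (\<rho> * t / 2))\<^sup>2 + (sin (\<rho> * t / 2) / \<rho>)\<^sup>2 * ((l$3)\<^sup>2 - (l$1)\<^sup>2 - (l$2)\<^sup>2)"
    by (simp add: det_2 ell_exp_nth \<rho>_def[symmetric] algebra_simps power2_eq_square add_divide_distrib diff_divide_distrib)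
  also have "\<dots> = (cos (\<rho> * t / 2))\<^sup>2 + (sin (\<rho> * t / 2))\<^sup>2"
    using \<rho> by (simp add: power_divide flip: \<rho>(2))
  finally show ?thesis by simp
qed

lemma det_rot2: "det (rot2 \<theta>) = 1"
  using sin_cos_squared_add[of "\<theta> / 2"] by (simp add: det_2 power2_eq_square algebra_simps)

text \<open>The \<open>X0\<close> parts cancel, as \<open>X0\<close> commutes with its exponential,
  and conjugation by \<open>rot2 \<theta>\<close> rotates the plane of \<open>X1\<close>,
  \<open>X2\<close> by the full angle. This turns the product rule for
  \<open>ell_exp l t ** rot2 (l$3 * t)\<close> into the equation of the flow.\<close>

lemma rot2_hat:
  "hat (vector [u, v, - w]) ** rot2 \<theta> + rot2 \<theta> ** hat (vector [0, 0, w]) =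
   rot2 \<theta> ** hat (vector [u * cos \<theta> + v * sin \<theta>, v * cos \<theta> - u * sin \<theta>, 0])"
proof -
  define C S where "C = cos (\<theta> / 2)" and "S = sin (\<theta> / 2)"
  have cs: "cos \<theta> = C * C - S * S" "sin \<theta> = 2 * S * C"
    using cos_double[of "\<theta> / 2"] sin_double[of "\<theta> / 2"] by (simp_all add: C_def S_def power2_eq_square)
  have one: "C * C + S * S = 1"
    using sin_cos_squared_add[of "\<theta> / 2"] by (simp add: C_def S_def power2_eq_square)
  define P Q where "P = u * cos \<theta> + v * sin \<theta>" and "Q = v * cos \<theta> - u * sin \<theta>"
  \<comment> \<open>The double-angle formulas leave a common factor \<open>C * C + S * S\<close>,
    which is 1.\<close>
  have "C * P - S * Q = (u * C + v * S) * (C * C + S * S)" "C * Q + S * P = (v * C - u * S) * (C * C + S * S)"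
    unfolding P_def Q_def cs by (simp_all add: algebra_simps)
  then have e: "C * P - S * Q = u * C + v * S" "C * Q + S * P = v * C - u * S"
    unfolding one by simp_all
  show ?thesis
    unfolding P_def[symmetric] Q_def[symmetric] matrix2_eq_iff using e
    by (simp add: matrix2_mult_nth C_def[symmetric] S_def[symmetric]) (simp add: field_simps)
qed

lemma is_hamiltonian_trajectory_ell_flow:
  assumes "det q = 1" "cov_r l > 0"
  shows "det (fst (ell_flow q l t)) = 1" "(ell_flow q l has_vector_derivative sr_field (ell_flow q l t)) (at t)"
proof -
  show "det (fst (ell_flow q l t)) = 1"
    by (simp add: ell_flow_def det_mul assms det_ell_exp det_rot2)
  let ?L = "\<lambda>t. vector [l$1 * cos (l$3 * t) + l$2 * sin (l$3 * t), l$2 * cos (l$3 * t) - l$1 * sin (l$3 * t), l$3] :: real^3"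
  have L: "(?L has_vector_derivative snd (sr_field (ell_flow q l t))) (at t)"
  proof (rule has_vector_derivative_vec)
    fix i :: 3
    show "((\<lambda>t. ?L t $ i) has_vector_derivative snd (sr_field (ell_flow q l t)) $ i) (at t)"
      using exhaust_3[of i]
      by (elim disjE) (auto simp: sr_field_def ell_flow_def algebra_simps simp flip: has_real_derivative_iff_has_vector_derivative
          intro!: derivative_eq_intros)
  qed
  let ?E = "ell_exp l t" and ?R = "rot2 (l$3 * t)"
  have "((\<lambda>t. q ** (ell_exp l t ** rot2 (l$3 * t))) has_vector_derivative
      q ** (?E ** (?R ** hat (vector [0, 0, l$3])) + ?E ** hat (vector [l$1, l$2, - l$3]) ** ?R)) (at t)"
    by (intro bounded_linear.has_vector_derivative[OF bounded_bilinear.bounded_linear_right[OF bounded_bilinear_matrix2_mult]]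
       bounded_bilinear.has_vector_derivative[OF bounded_bilinear_matrix2_mult]
       has_vector_derivative_ell_exp assms has_vector_derivative_rot2)
  also have "?E ** (?R ** hat (vector [0, 0, l$3])) + ?E ** hat (vector [l$1, l$2, - l$3]) ** ?R =
     ?E ** (hat (vector [l$1, l$2, - l$3]) ** ?R + ?R ** hat (vector [0, 0, l$3]))"
    by (simp add: matrix_add_ldistrib matrix_mul_assoc)
  also have "\<dots> = ?E ** ?R ** hat (vector [?L t $ 1, ?L t $ 2, 0])"
    unfolding rot2_hat by (simp add: matrix_mul_assoc)
  finally have Q: "((\<lambda>t. q ** (ell_exp l t ** rot2 (l$3 * t))) has_vector_derivative fst (sr_field (ell_flow q l t))) (at t)"
    by (simp add: sr_field_def ell_flow_def matrix_mul_assoc)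
  show "(ell_flow q l has_vector_derivative sr_field (ell_flow q l t)) (at t)"
    using has_vector_derivative_Pair[OF Q L] by (simp add: ell_flow_def[abs_def])
qed

lemma hamiltonian_flow_eq_ell_flow:
  assumes "det q = 1" "cov_r l > 0"
  shows "hamiltonian_flow sr_hamiltonian t (q, l) = ell_flow q l t"
proof -
  note tr = is_hamiltonian_trajectory_ell_flow[OF assms]
  have init: "ell_flow q l 0 = (q, l)"
    by (simp add: ell_flow_def matrix2_eq_iff matrix2_mult_nth ell_exp_nth vec3_eq_iff)
  have "(THE \<gamma>. is_hamiltonian_trajectory sr_hamiltonian \<gamma> \<and> \<gamma> 0 = (q, l)) = ell_flow q l"
  proof (rule the_equality)
    show "is_hamiltonian_trajectory sr_hamiltonian (ell_flow q l) \<and> ell_flow q l 0 = (q, l)"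
      using tr init by (simp add: is_hamiltonian_trajectory_sr_iff)
    show "\<gamma> = ell_flow q l" if "is_hamiltonian_trajectory sr_hamiltonian \<gamma> \<and> \<gamma> 0 = (q, l)" for \<gamma>
      using that tr init by (intro sr_trajectory_unique) (auto simp: is_hamiltonian_trajectory_sr_iff)
  qed
  then show ?thesis by (simp add: hamiltonian_flow_def)
qed

lemma sr_exp_eq:
  assumes "det q = 1" "cov_r l > 0"
  shows "sr_exp q l = q ** (ell_exp l 1 ** rot2 (l$3))"
  by (simp add: sr_exp_def hamiltonian_flow_eq_ell_flow[OF assms] ell_flow_def)

section \<open>Charts of the group\<close>

text \<open>Identify \<open>\<real>\<^sup>2\<close> with the complex plane. A real \<open>2 \<times> 2\<close> matrix acts as \<open>z \<mapsto> \<alpha> z + \<beta> cnj z\<close>,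
  with determinant \<open>|\<alpha>|\<^sup>2 - |\<beta>|\<^sup>2\<close>. The parameters \<open>k\<close>, \<open>j\<close> are unit complex numbers;
  \<open>conf_re k\<close>, \<open>conf_im k\<close> are the real and imaginary parts of \<open>k \<alpha>\<close>, and \<open>anti_re j\<close>,
  \<open>anti_im j\<close> those of \<open>j \<beta>\<close>.\<close>

definition conf_re :: "real \<times> real \<Rightarrow> real^2^2 \<Rightarrow> real" where
  "conf_re k P = (fst k * (P$1$1 + P$2$2) - snd k * (P$2$1 - P$1$2)) / 2"

definition conf_im :: "real \<times> real \<Rightarrow> real^2^2 \<Rightarrow> real" where
  "conf_im k P = (fst k * (P$2$1 - P$1$2) + snd k * (P$1$1 + P$2$2)) / 2"

definition anti_re :: "real \<times> real \<Rightarrow> real^2^2 \<Rightarrow> real" where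
  "anti_re j P = (fst j * (P$1$1 - P$2$2) - snd j * (P$1$2 + P$2$1)) / 2"

definition anti_im :: "real \<times> real \<Rightarrow> real^2^2 \<Rightarrow> real" where
  "anti_im j P = (fst j * (P$1$2 + P$2$1) + snd j * (P$1$1 - P$2$2)) / 2"

text \<open>The matrix with \<open>k \<alpha> = a1 + i a2\<close> and
  \<open>j \<beta> = b1 + i b2\<close>, obtained by multiplying with the conjugates of
  \<open>k\<close> and \<open>j\<close>.\<close>

definition conf_anti :: "real \<times> real \<Rightarrow> real \<times> real \<Rightarrow> real \<Rightarrow> real \<Rightarrow> real \<Rightarrow> real \<Rightarrow> real^2^2" where
  "conf_anti k j a1 a2 b1 b2 =
    (let a = fst k * a1 + snd k * a2; b = fst k * a2 - snd k * a1;
         c = fst j * b1 + snd j * b2; d = fst j * b2 - snd j * b1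
     in vector [vector [a + c, d - b], vector [b + d, a - c]])"

lemma conf_anti_nth [simp]:
  "conf_anti k j a1 a2 b1 b2 $ 1 $ 1 = fst k * a1 + snd k * a2 + (fst j * b1 + snd j * b2)"
  "conf_anti k j a1 a2 b1 b2 $ 1 $ 2 = fst j * b2 - snd j * b1 - (fst k * a2 - snd k * a1)"
  "conf_anti k j a1 a2 b1 b2 $ 2 $ 1 = fst k * a2 - snd k * a1 + (fst j * b2 - snd j * b1)"
  "conf_anti k j a1 a2 b1 b2 $ 2 $ 2 = fst k * a1 + snd k * a2 - (fst j * b1 + snd j * b2)"
  by (simp_all add: conf_anti_def Let_def)

text \<open>Oriented as a rewrite rule that eliminates the square of \<open>fst k\<close> inside
  expanded products.\<close>

lemma unit_square:
  fixes k :: "real \<times> real"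
  assumes "(fst k)\<^sup>2 + (snd k)\<^sup>2 = 1"
  shows "fst k * (fst k * x) = x - snd k * (snd k * x)"
  using assms by algebra

lemma conf_anti_components:
  assumes "(fst k)\<^sup>2 + (snd k)\<^sup>2 = 1" "(fst j)\<^sup>2 + (snd j)\<^sup>2 = 1"
  shows "conf_re k (conf_anti k j a1 a2 b1 b2) = a1" "conf_im k (conf_anti k j a1 a2 b1 b2) = a2"
    "anti_re j (conf_anti k j a1 a2 b1 b2) = b1" "anti_im j (conf_anti k j a1 a2 b1 b2) = b2"
    "det (conf_anti k j a1 a2 b1 b2) = a1\<^sup>2 + a2\<^sup>2 - b1\<^sup>2 - b2\<^sup>2"
proof -
  note u = unit_square[OF assms(1)] unit_square[OF assms(2)]
  show "conf_re k (conf_anti k j a1 a2 b1 b2) = a1" "conf_im k (conf_anti k j a1 a2 b1 b2) = a2"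
    "anti_re j (conf_anti k j a1 a2 b1 b2) = b1" "anti_im j (conf_anti k j a1 a2 b1 b2) = b2"
    by (simp_all add: conf_re_def conf_im_def anti_re_def anti_im_def algebra_simps u)
  have "det (conf_anti k j a1 a2 b1 b2) =
     ((fst k)\<^sup>2 + (snd k)\<^sup>2) * (a1\<^sup>2 + a2\<^sup>2) - ((fst j)\<^sup>2 + (snd j)\<^sup>2) * (b1\<^sup>2 + b2\<^sup>2)"
    by (simp add: det_2 algebra_simps power2_eq_square)
  then show "det (conf_anti k j a1 a2 b1 b2) = a1\<^sup>2 + a2\<^sup>2 - b1\<^sup>2 - b2\<^sup>2"
    by (simp add: assms)
qed

lemma conf_anti_inverse:
  assumes "(fst k)\<^sup>2 + (snd k)\<^sup>2 = 1" "(fst j)\<^sup>2 + (snd j)\<^sup>2 = 1"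
  shows "conf_anti k j (conf_re k P) (conf_im k P) (anti_re j P) (anti_im j P) = P"
  by (simp add: matrix2_eq_iff conf_re_def conf_im_def anti_re_def anti_im_def field_simps
      unit_square[OF assms(1)] unit_square[OF assms(2)])

lemma det_adj2: "det (adj2 A) = det A"
  by (simp add: det_2)

text \<open>The order of the entries is chosen so that the exponential map on \<open>C^1\<close>
  reads \<open>(x z, y, z)\<close>.\<close>

definition sl2_coords :: "real^2^2 \<Rightarrow> real \<times> real \<Rightarrow> real \<times> real \<Rightarrow> real^2^2 \<Rightarrow> real^3" where
  "sl2_coords q k j A =
    vector [anti_im j (adj2 q ** A), conf_im k (adj2 q ** A), anti_re j (adj2 q ** A)]"

text \<open>On \<open>SL2\<close> one has \<open>|\<alpha>|^2 = 1 + |\<beta>|^2\<close>, so where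
  the real part of \<open>k \<alpha>\<close> is positive it is a square root of a polynomial in the
  other three components. This recovers the matrix smoothly; the image is the set \<open>Y\<close>
  where the radicand is positive.\<close>

lemma chart_on_sl2_coords:
  assumes q: "det q = 1" and k: "(fst k)\<^sup>2 + (snd k)\<^sup>2 = 1" and j: "(fst j)\<^sup>2 + (snd j)\<^sup>2 = 1"
  shows "chart_on SL2 {A \<in> SL2. conf_re k (adj2 q ** A) > 0} (sl2_coords q k j)"
proof -
  define W where "W = {A. conf_re k (adj2 q ** A) > 0}"
  define Y where "Y = {y :: real^3. 1 + (y$1)\<^sup>2 + (y$3)\<^sup>2 - (y$2)\<^sup>2 > 0}"
  define g where "g y = q ** conf_anti k j (sqrt (1 + (y$1)\<^sup>2 + (y$3)\<^sup>2 - (y$2)\<^sup>2)) (y$2) (y$3) (y$1)" for y :: "real^3"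
  note comp = conf_anti_components[OF k j]
  have [simp]: "adj2 q ** (q ** A) = A" "q ** (adj2 q ** A) = A" for A
    by (simp_all add: matrix_mul_assoc adj2_left adj2_right q)
  have "smooth_on UNIV (\<lambda>A. conf_re k (adj2 q ** A))"
    unfolding conf_re_def matrix2_mult_nth by (simp add: smooth_intros)
  then have oW: "open W"
    unfolding W_def by (intro open_Collect_less smooth_on_imp_continuous_on) (simp add: smooth_on_const)
  have sW: "smooth_on W (sl2_coords q k j)"
    unfolding sl2_coords_def anti_im_def anti_re_def conf_im_def matrix2_mult_nth
    by (simp add: smooth_intros oW)
  have key: "(conf_re k (adj2 q ** A))\<^sup>2 =
      1 + (anti_im j (adj2 q ** A))\<^sup>2 + (anti_re j (adj2 q ** A))\<^sup>2 - (conf_im k (adj2 q ** A))\<^sup>2"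
    if "A \<in> SL2" for A
  proof -
    let ?P = "adj2 q ** A"
    have "det ?P = 1" using that q by (simp add: det_mul SL2_def det_adj2)
    then show ?thesis
      using comp(5)[of "conf_re k ?P" "conf_im k ?P" "anti_re j ?P" "anti_im j ?P"]
      by (simp add: conf_anti_inverse[OF k j])
  qed
  have gP: "g (sl2_coords q k j A) = A" if "A \<in> SL2 \<inter> W" for A
    using that key[of A, symmetric] unfolding g_def sl2_coords_def by (simp add: W_def conf_anti_inverse[OF k j])
  have img: "sl2_coords q k j ` (SL2 \<inter> W) = Y"
  proof
    show "sl2_coords q k j ` (SL2 \<inter> W) \<subseteq> Y"
    proof clarify
      fix A assume A: "A \<in> SL2" "A \<in> W"
      have "(conf_re k (adj2 q ** A))\<^sup>2 > 0" using A by (simp add: W_def)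
      then show "sl2_coords q k j A \<in> Y" unfolding key[OF A(1)] by (simp add: Y_def sl2_coords_def)
    qed
    show "Y \<subseteq> sl2_coords q k j ` (SL2 \<inter> W)"
    proof
      fix y assume y: "y \<in> Y"
      have "g y \<in> SL2 \<inter> W"
        using y by (simp add: SL2_def W_def g_def det_mul q comp Y_def)
      moreover have "sl2_coords q k j (g y) = y"
        by (simp add: sl2_coords_def g_def comp vec3_eq_iff)
      ultimately show "y \<in> sl2_coords q k j ` (SL2 \<inter> W)" by (metis image_eqI)
    qed
  qed
  have oY: "open Y" unfolding Y_def by (intro open_Collect_less continuous_intros)
  have sY: "smooth_on Y g"
  proof (intro smooth_on_vec oY)
    fix a b :: 2
    have "smooth_on Y (\<lambda>y. sqrt (1 + (y$1)\<^sup>2 + (y$3)\<^sup>2 - (y$2)\<^sup>2))"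
      by (rule smooth_on_sqrt[OF oY]) (simp_all add: smooth_intros oY, simp add: Y_def)
    then show "smooth_on Y (\<lambda>y. g y $ a $ b)"
      using exhaust_2[of b] unfolding g_def matrix2_mult_nth
      by (elim disjE) (simp_all add: smooth_intros oY)
  qed
  have V: "{A \<in> SL2. conf_re k (adj2 q ** A) > 0} = SL2 \<inter> W" by (auto simp: W_def)
  show ?thesis unfolding chart_on_def V
  proof (intro conjI)
    show "\<exists>W'. open W' \<and> SL2 \<inter> W = SL2 \<inter> W' \<and> smooth_on W' (sl2_coords q k j)"
      using oW sW by (intro exI[of _ W]) simp
    show "open (sl2_coords q k j ` (SL2 \<inter> W))" by (simp add: img oY)
    show "\<exists>g. smooth_on (sl2_coords q k j ` (SL2 \<inter> W)) g \<and> (\<forall>p\<in>SL2 \<inter> W. g (sl2_coords q k j p) = p)"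
      using gP sY by (intro exI[of _ g]) (simp add: img)
  qed
qed

section \<open>Differentials of maps into three-space\<close>

lemma has_derivative_vector3:
  fixes f g h :: "'a::real_normed_vector \<Rightarrow> real"
  assumes "(f has_derivative f') F" "(g has_derivative g') F" "(h has_derivative h') F"
  shows "((\<lambda>x. vector [f x, g x, h x] :: real^3) has_derivative (\<lambda>v. vector [f' v, g' v, h' v])) F"
proof -
  have eq: "(vector [a, b, c] :: real^3) = axis 1 a + axis 2 b + axis 3 c" for a b c :: real
    by (simp add: vec3_eq_iff axis_def)
  show ?thesis unfolding eq
    by (intro has_derivative_add bounded_linear.has_derivative[OF bounded_linear_axis] assms)
qed

lemma frechet_derivative_vector3_injective:
  fixes f g h :: "real^3 \<Rightarrow> real"
  assumes "(f has_derivative f') (at p)" "(g has_derivative g') (at p)" "(h has_derivative h') (at p)"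
    and "\<And>v. f' v = 0 \<Longrightarrow> g' v = 0 \<Longrightarrow> h' v = 0 \<Longrightarrow> v = 0"
    and "frechet_derivative (\<lambda>x. vector [f x, g x, h x] :: real^3) (at p) v = 0"
  shows "v = 0"
proof -
  have "vector [f' v, g' v, h' v] = (0 :: real^3)"
    using assms(5) frechet_derivative_at[OF has_derivative_vector3[OF assms(1-3)]] by metis
  then show ?thesis using assms(4) by (simp add: vec3_eq_iff)
qed

section \<open>The exponential map in coordinates\<close>

definition ell_rho :: "real^3 \<Rightarrow> real" where
  "ell_rho l = sqrt (cov_r l)"

definition ell_c :: "real^3 \<Rightarrow> real" where
  "ell_c l = cos (ell_rho l / 2)"

definition ell_s :: "real^3 \<Rightarrow> real" where
  "ell_s l = sin (ell_rho l / 2) / ell_rho l"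

text \<open>Real and imaginary parts of \<open>(c - i m) (c0 + i m0) exp (i T)\<close>.\<close>

definition twist_re :: "real \<Rightarrow> real \<Rightarrow> real \<Rightarrow> real \<Rightarrow> real \<Rightarrow> real" where
  "twist_re c0 m0 c m T = (c * c0 + m * m0) * cos T - (c * m0 - m * c0) * sin T"

definition twist_im :: "real \<Rightarrow> real \<Rightarrow> real \<Rightarrow> real \<Rightarrow> real \<Rightarrow> real" where
  "twist_im c0 m0 c m T = (c * m0 - m * c0) * cos T + (c * c0 + m * m0) * sin T"

text \<open>Separates the constant factor belonging to \<open>l0\<close> (angle \<open>b\<close>)
  from the variable one (angle \<open>a\<close>), as needed to recognise entries rotated by fixed
  units.\<close>

lemma twist_diff:
  "twist_re c0 m0 c m (a - b) =
    (c0 * cos b + m0 * sin b) * (c * cos a + m * sin a) - (m0 * cos b - c0 * sin b) * (c * sin a - m * cos a)"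
  "twist_im c0 m0 c m (a - b) =
    (c0 * cos b + m0 * sin b) * (c * sin a - m * cos a) + (m0 * cos b - c0 * sin b) * (c * cos a + m * sin a)"
  by (simp_all add: twist_re_def twist_im_def cos_diff sin_diff algebra_simps)

text \<open>Multiplicativity of the complex modulus, with \<open>exp (i T)\<close> of modulus
  1.\<close>

lemma twist_sum_squares:
  "(twist_re c0 m0 c m T)\<^sup>2 + (twist_im c0 m0 c m T)\<^sup>2 = (c\<^sup>2 + m\<^sup>2) * (c0\<^sup>2 + m0\<^sup>2)"
proof -
  have "(twist_re c0 m0 c m T)\<^sup>2 + (twist_im c0 m0 c m T)\<^sup>2 =
     ((c * c0 + m * m0)\<^sup>2 + (c * m0 - m * c0)\<^sup>2) * ((sin T)\<^sup>2 + (cos T)\<^sup>2)"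
    by (simp only: twist_re_def twist_im_def power2_eq_square algebra_simps)
  then show ?thesis by (simp add: power2_eq_square algebra_simps)
qed

lemma twist_base: "twist_re c m c m 0 = c\<^sup>2 + m\<^sup>2" "twist_im c m c m 0 = 0"
  by (simp_all add: twist_re_def twist_im_def power2_eq_square)

lemma has_derivative_twist_im_base:
  assumes "(c has_derivative c') (at p)" "(m has_derivative m') (at p)" "(T has_derivative T') (at p)" "T p = 0"
  shows "((\<lambda>x. twist_im (c p) (m p) (c x) (m x) (T x)) has_derivative
    (\<lambda>h. c' h * m p - m' h * c p + ((c p)\<^sup>2 + (m p)\<^sup>2) * T' h)) (at p)"
  unfolding twist_im_def
  by (rule has_derivative_eq_rhs, (rule derivative_intros assms)+)
    (simp add: assms(4) fun_eq_iff power2_eq_square algebra_simps)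

lemma smooth_on_twist:
  assumes "open S" "smooth_on S c" "smooth_on S m" "smooth_on S T"
  shows "smooth_on S (\<lambda>x. twist_re c0 m0 (c x) (m x) (T x))" "smooth_on S (\<lambda>x. twist_im c0 m0 (c x) (m x) (T x))"
  unfolding twist_re_def twist_im_def by (simp_all add: smooth_intros assms)

lemma open_elliptic: "open {l. cov_r l > 0}"
  unfolding cov_r_def by (intro open_Collect_less continuous_intros)

lemma smooth_on_elliptic:
  assumes "open S" "\<And>l. l \<in> S \<Longrightarrow> cov_r l > 0"
  shows "smooth_on S ell_rho" "smooth_on S ell_c" "smooth_on S ell_s"
proof -
  have "smooth_on S cov_r" unfolding cov_r_def[abs_def] by (simp add: smooth_intros assms(1))
  then show r: "smooth_on S ell_rho"
    unfolding ell_rho_def[abs_def] using assms by (intro smooth_on_sqrt)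
  have h: "smooth_on S (\<lambda>l. ell_rho l / 2)" by (simp add: smooth_on_divide smooth_on_const r assms(1))
  have nz: "ell_rho l \<noteq> 0" if "l \<in> S" for l
    using assms(2)[OF that] by (simp add: ell_rho_def)
  show "smooth_on S ell_c"
    unfolding ell_c_def[abs_def] by (rule smooth_on_cos[OF assms(1) h])
  show "smooth_on S ell_s"
    unfolding ell_s_def[abs_def] by (rule smooth_on_divide[OF assms(1) nz smooth_on_sin[OF assms(1) h] r])
qed

definition ell_drho :: "real^3 \<Rightarrow> real^3 \<Rightarrow> real" where
  "ell_drho l h = (l$3 * h$3 - l$1 * h$1 - l$2 * h$2) / ell_rho l"

lemma has_derivative_nth: "((\<lambda>x :: real^'n. x $ i) has_derivative (\<lambda>h. h $ i)) (at p)"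
  by (intro bounded_linear.has_derivative[OF bounded_linear_vec_nth] has_derivative_ident)

text \<open>In the derivative of \<open>ell_s\<close> the numerator is half the function whose zeros
  define \<open>C^0\<close>.\<close>

lemma has_derivative_elliptic:
  assumes "cov_r l > 0"
  shows "(ell_rho has_derivative ell_drho l) (at l)"
    "(ell_c has_derivative (\<lambda>h. - (sin (ell_rho l / 2) / 2) * ell_drho l h)) (at l)"
    "(ell_s has_derivative (\<lambda>h. ((cos (ell_rho l / 2) / 2 * ell_rho l - sin (ell_rho l / 2)) / (ell_rho l)\<^sup>2) * ell_drho l h)) (at l)"
proof -
  have \<rho>: "ell_rho l > 0" using assms by (simp add: ell_rho_def)
  have "(cov_r has_derivative (\<lambda>h. 2 * (l$3 * h$3 - l$1 * h$1 - l$2 * h$2))) (at l)"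
    unfolding cov_r_def[abs_def]
    by (rule has_derivative_eq_rhs, (rule derivative_intros has_derivative_nth)+)
      (simp add: fun_eq_iff algebra_simps)
  from has_derivative_compose[OF this DERIV_real_sqrt[OF assms, unfolded has_field_derivative_def]]
  have r': "(ell_rho has_derivative (\<lambda>h. inverse (sqrt (cov_r l)) / 2 * (2 * (l$3 * h$3 - l$1 * h$1 - l$2 * h$2)))) (at l)"
    unfolding ell_rho_def[abs_def] .
  have e: "inverse s / 2 * (2 * a) = a / s" for s a :: real by (simp add: inverse_eq_divide)
  have "(\<lambda>h. inverse (sqrt (cov_r l)) / 2 * (2 * (l$3 * h$3 - l$1 * h$1 - l$2 * h$2))) = ell_drho l"
    unfolding e by (rule ext) (simp add: ell_drho_def ell_rho_def)
  with r' show r: "(ell_rho has_derivative ell_drho l) (at l)" by simp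
  have half: "((\<lambda>x. x / 2) has_real_derivative 1 / 2) (at a)" for a
    by (rule DERIV_cdivide[OF DERIV_ident])
  have dcos: "((\<lambda>x. cos (x / 2)) has_field_derivative - (sin (ell_rho l / 2) / 2)) (at (ell_rho l))"
    by (rule DERIV_cong[OF DERIV_chain2[OF DERIV_cos half]]) simp
  from has_derivative_compose[OF r dcos[unfolded has_field_derivative_def]]
  show "(ell_c has_derivative (\<lambda>h. - (sin (ell_rho l / 2) / 2) * ell_drho l h)) (at l)"
    unfolding ell_c_def[abs_def] .
  have dsin: "((\<lambda>x. sin (x / 2) / x) has_field_derivative
     (cos (ell_rho l / 2) / 2 * ell_rho l - sin (ell_rho l / 2)) / (ell_rho l)\<^sup>2) (at (ell_rho l))"
    using \<rho> by (intro DERIV_cong[OF DERIV_divide[OF DERIV_chain2[OF DERIV_sin half] DERIV_ident]])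
      (simp_all add: power2_eq_square)
  from has_derivative_compose[OF r dsin[unfolded has_field_derivative_def]]
  show "(ell_s has_derivative (\<lambda>h. ((cos (ell_rho l / 2) / 2 * ell_rho l - sin (ell_rho l / 2)) / (ell_rho l)\<^sup>2) * ell_drho l h)) (at l)"
    unfolding ell_s_def[abs_def] .
qed

section \<open>Rotated coordinates at a fixed elliptic covector\<close>

locale elliptic_point =
  fixes q :: "real^2^2" and l0 :: "real^3"
  assumes det_q: "det q = 1" and r_pos: "cov_r l0 > 0" and H_pos: "(l0$1)\<^sup>2 + (l0$2)\<^sup>2 > 0"
begin

definition "c0 = ell_c l0"
definition "m0 = ell_s l0 * l0$3"
definition "n0 = sqrt (c0\<^sup>2 + m0\<^sup>2)"
definition "s0 = sqrt ((l0$1)\<^sup>2 + (l0$2)\<^sup>2)"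

text \<open>The rotations that make \<open>\<alpha>\<close> and \<open>\<beta> / s\<close> real and positive at \<open>l0\<close>; the rotated quantities
  are \<open>a1 + i a2\<close> and \<open>\<beta>1 + i \<beta>2\<close>.\<close>

definition "conf_unit = ((c0 * cos (l0$3 / 2) + m0 * sin (l0$3 / 2)) / n0, (m0 * cos (l0$3 / 2) - c0 * sin (l0$3 / 2)) / n0)"
definition "anti_unit = ((l0$1 * cos (l0$3 / 2) + l0$2 * sin (l0$3 / 2)) / s0, (l0$1 * sin (l0$3 / 2) - l0$2 * cos (l0$3 / 2)) / s0)"

definition "a1 l = twist_re c0 m0 (ell_c l) (ell_s l * l$3) (l$3 / 2 - l0$3 / 2) / n0"
definition "a2 l = twist_im c0 m0 (ell_c l) (ell_s l * l$3) (l$3 / 2 - l0$3 / 2) / n0"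
definition "\<beta>1 l = twist_re (l0$1) (l0$2) (l$1) (l$2) (l$3 / 2 - l0$3 / 2) / s0"
text \<open>The twist describes the conjugate of
  \<open>\<beta> / s = (u + i v) exp (- i w/2)\<close>, whence the minus sign.\<close>

definition "\<beta>2 l = - twist_im (l0$1) (l0$2) (l$1) (l$2) (l$3 / 2 - l0$3 / 2) / s0"

lemma s0_pos: "s0 > 0" and s0_square: "s0\<^sup>2 = (l0$1)\<^sup>2 + (l0$2)\<^sup>2"
  using H_pos by (simp_all add: s0_def)

lemma rho_pos: "ell_rho l0 > 0"
  using r_pos by (simp add: ell_rho_def)

lemma l0_3: "l0$3 \<noteq> 0"
  using r_pos H_pos by (auto simp: cov_r_def)

text \<open>Sine and cosine have no common zero and \<open>l0$3\<close> is nonzero, so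
  \<open>\<alpha>\<close> cannot vanish.\<close>

lemma n0_pos: "n0 > 0"
proof -
  have "c0 \<noteq> 0 \<or> m0 \<noteq> 0"
    using l0_3 rho_pos sin_zero_abs_cos_one[of "ell_rho l0 / 2"] by (auto simp: c0_def m0_def ell_c_def ell_s_def)
  then show ?thesis by (simp add: n0_def sum_power2_gt_zero_iff)
qed

lemma n0_square: "n0\<^sup>2 = c0\<^sup>2 + m0\<^sup>2"
  by (simp add: n0_def)

lemma units: "(fst conf_unit)\<^sup>2 + (snd conf_unit)\<^sup>2 = 1" "(fst anti_unit)\<^sup>2 + (snd anti_unit)\<^sup>2 = 1"
proof -
  have rot: "(x * cos t + y * sin t)\<^sup>2 + (y * cos t - x * sin t)\<^sup>2 = x\<^sup>2 + y\<^sup>2"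
    "(x * cos t + y * sin t)\<^sup>2 + (x * sin t - y * cos t)\<^sup>2 = x\<^sup>2 + y\<^sup>2" for x y t :: real
  proof -
    have "(x * cos t + y * sin t)\<^sup>2 + (y * cos t - x * sin t)\<^sup>2 = (x\<^sup>2 + y\<^sup>2) * ((sin t)\<^sup>2 + (cos t)\<^sup>2)"
      by (simp only: power2_eq_square algebra_simps)
    then show "(x * cos t + y * sin t)\<^sup>2 + (y * cos t - x * sin t)\<^sup>2 = x\<^sup>2 + y\<^sup>2" by simp
    then show "(x * cos t + y * sin t)\<^sup>2 + (x * sin t - y * cos t)\<^sup>2 = x\<^sup>2 + y\<^sup>2"
      by (simp add: power2_commute)
  qed
  show "(fst conf_unit)\<^sup>2 + (snd conf_unit)\<^sup>2 = 1" "(fst anti_unit)\<^sup>2 + (snd anti_unit)\<^sup>2 = 1"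
    using n0_pos s0_pos
    by (simp_all add: conf_unit_def anti_unit_def power_divide rot
        flip: add_divide_distrib n0_square s0_square)
qed

lemma base_values: "a1 l0 = n0" "a2 l0 = 0" "\<beta>1 l0 = s0" "\<beta>2 l0 = 0"
proof -
  have t: "l0$3 / 2 - l0$3 / 2 = 0" by simp
  show "a1 l0 = n0" "a2 l0 = 0" "\<beta>1 l0 = s0" "\<beta>2 l0 = 0"
    unfolding a1_def a2_def \<beta>1_def \<beta>2_def t m0_def[symmetric] c0_def[symmetric] twist_base
    using n0_pos s0_pos by (simp_all flip: n0_square s0_square) (simp_all add: power2_eq_square)
qed

text \<open>Sums and differences of entries give \<open>\<alpha>\<close> and \<open>\<beta>\<close>
  with angle \<open>l$3 / 2\<close>; multiplication by the fixed units replaces this angle by its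
  increment from \<open>l0\<close>, as in \<open>twist_diff\<close>.\<close>

lemma components_sr_exp:
  assumes "cov_r l > 0"
  defines "P \<equiv> adj2 q ** sr_exp q l"
  shows "conf_re conf_unit P = a1 l" "conf_im conf_unit P = a2 l"
    "anti_re anti_unit P = ell_s l * \<beta>1 l" "anti_im anti_unit P = ell_s l * \<beta>2 l"
proof -
  have P: "P = ell_exp l 1 ** rot2 (l$3)"
    unfolding P_def sr_exp_eq[OF det_q assms(1)] by (simp add: matrix_mul_assoc adj2_left det_q)
  have "P$1$1 + P$2$2 = 2 * (ell_c l * cos (l$3/2) + (ell_s l * l$3) * sin (l$3/2))"
    "P$2$1 - P$1$2 = 2 * (ell_c l * sin (l$3/2) - (ell_s l * l$3) * cos (l$3/2))"
    "P$1$1 - P$2$2 = 2 * (ell_s l * (l$1 * cos (l$3/2) + l$2 * sin (l$3/2)))"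
    "P$1$2 + P$2$1 = 2 * (ell_s l * (l$2 * cos (l$3/2) - l$1 * sin (l$3/2)))"
    unfolding P matrix2_mult_nth ell_exp_nth rot2_nth
    by (simp_all add: ell_rho_def ell_c_def ell_s_def algebra_simps add_divide_distrib diff_divide_distrib)
  note e = this
  show "conf_re conf_unit P = a1 l" "conf_im conf_unit P = a2 l"
    unfolding conf_re_def conf_im_def e a1_def a2_def twist_diff conf_unit_def
    using n0_pos by (simp_all add: field_simps)
  show "anti_re anti_unit P = ell_s l * \<beta>1 l" "anti_im anti_unit P = ell_s l * \<beta>2 l"
    unfolding anti_re_def anti_im_def e \<beta>1_def \<beta>2_def twist_diff anti_unit_def
    using s0_pos by (simp_all add: field_simps)
qed

lemma sl2_coords_sr_exp:
  assumes "cov_r l > 0"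
  shows "sl2_coords q conf_unit anti_unit (sr_exp q l) = vector [ell_s l * \<beta>2 l, a2 l, ell_s l * \<beta>1 l]"
  by (simp add: sl2_coords_def components_sr_exp[OF assms])

lemma sr_exp_in_SL2: "cov_r l > 0 \<Longrightarrow> sr_exp q l \<in> SL2"
  by (simp add: sr_exp_eq det_q SL2_def det_mul det_ell_exp det_rot2)

lemma continuous_on_sr_exp: "continuous_on {l. cov_r l > 0} (sr_exp q)"
proof -
  have e: "smooth_on {l. cov_r l > 0} (\<lambda>l. (q ** (ell_exp l 1 ** rot2 (l$3))) $ i $ j)" for i j
  proof -
    note s = smooth_on_elliptic[OF open_elliptic, simplified]
    have "smooth_on {l. cov_r l > 0} (\<lambda>l. ell_exp l 1 $ i $ j)" for i j
      using exhaust_2[of i] exhaust_2[of j] 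
      by (elim disjE) (simp_all add: ell_exp_nth smooth_intros s open_elliptic flip: ell_rho_def ell_c_def ell_s_def)
    moreover have "smooth_on {l. cov_r l > 0} (\<lambda>l. rot2 (l$3) $ i $ j)" for i j
      using exhaust_2[of i] exhaust_2[of j] by (elim disjE) (simp_all add: smooth_intros open_elliptic)
    ultimately show ?thesis
      unfolding matrix2_mult_nth by (simp add: smooth_intros open_elliptic)
  qed
  have "smooth_on {l. cov_r l > 0} (\<lambda>l. q ** (ell_exp l 1 ** rot2 (l$3)))"
    by (intro smooth_on_vec open_elliptic e)
  from smooth_on_imp_continuous_on[OF this] show ?thesis
    by (rule continuous_on_cong[THEN iffD1, rotated -1]) (simp_all add: sr_exp_eq det_q)
qed

lemma smooth_on_coordinates:
  assumes "open S" "\<And>l. l \<in> S \<Longrightarrow> cov_r l > 0"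
  shows "smooth_on S a2" "smooth_on S \<beta>1" "smooth_on S \<beta>2"
  unfolding a2_def[abs_def] \<beta>1_def[abs_def] \<beta>2_def[abs_def]
  using n0_pos s0_pos
  by (simp_all add: smooth_intros smooth_on_twist smooth_on_elliptic[OF assms] assms(1))

lemma has_derivative_\<beta>2:
  "(\<beta>2 has_derivative (\<lambda>h. (h$2 * l0$1 - h$1 * l0$2 - s0\<^sup>2 * (h$3 / 2)) / s0)) (at l0)"
proof -
  have T: "((\<lambda>l. l$3 / 2 - l0$3 / 2) has_derivative (\<lambda>h. h$3 / 2)) (at l0)"
    by (rule has_derivative_eq_rhs, rule has_derivative_diff[OF
          bounded_linear.has_derivative[OF bounded_linear_divide has_derivative_nth] has_derivative_const]) simp
  have "((\<lambda>l. twist_im (l0$1) (l0$2) (l$1) (l$2) (l$3 / 2 - l0$3 / 2)) has_derivative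
    (\<lambda>h. h$1 * l0$2 - h$2 * l0$1 + ((l0$1)\<^sup>2 + (l0$2)\<^sup>2) * (h$3 / 2))) (at l0)"
    by (rule has_derivative_twist_im_base[OF has_derivative_nth has_derivative_nth T]) simp
  then have "((\<lambda>l. twist_im (l0$1) (l0$2) (l$1) (l$2) (l$3 / 2 - l0$3 / 2) * (- 1 / s0)) has_derivative
    (\<lambda>h. (h$1 * l0$2 - h$2 * l0$1 + ((l0$1)\<^sup>2 + (l0$2)\<^sup>2) * (h$3 / 2)) * (- 1 / s0))) (at l0)"
    by (rule has_derivative_mult_left)
  then show ?thesis
    unfolding \<beta>2_def[abs_def] s0_square using s0_pos
    by (rule_tac has_derivative_eq_rhs) (auto simp: fun_eq_iff field_simps)
qed

text \<open>As \<open>\<beta>2\<close> vanishes at \<open>l0\<close>, the quotient rule leaves the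
  derivative of \<open>\<beta>2\<close> divided by \<open>\<beta>1 l0 = s0\<close>.\<close>

lemma has_derivative_ratio:
  "((\<lambda>l. \<beta>2 l / \<beta>1 l) has_derivative (\<lambda>h. (h$2 * l0$1 - h$1 * l0$2 - s0\<^sup>2 * (h$3 / 2)) / s0\<^sup>2)) (at l0)"
proof -
  have "(\<beta>1 has_derivative frechet_derivative \<beta>1 (at l0)) (at l0)"
    using smooth_on_has_derivative[OF smooth_on_coordinates(2)[OF open_elliptic]] r_pos by simp
  from has_derivative_divide'[OF has_derivative_\<beta>2 this]
  show ?thesis using s0_pos
    by (rule_tac has_derivative_eq_rhs) (auto simp: base_values fun_eq_iff power2_eq_square)
qed

end

section \<open>Partial derivatives and rotating complex numbers\<close>

lemma smooth_on_partial_fst: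
  fixes f :: "real \<times> 'a::real_normed_vector \<Rightarrow> real"
  assumes "smooth_on \<Omega> f" "(x, y) \<in> \<Omega>"
  shows "((\<lambda>t. f (t, y)) has_real_derivative frechet_derivative f (at (x, y)) (1, 0)) (at x)"
proof -
  note f = smooth_on_has_derivative[OF assms]
  have "((\<lambda>t. (t, y)) has_derivative (\<lambda>s. (s, 0))) (at x)"
    by (intro has_derivative_Pair has_derivative_ident has_derivative_const)
  from has_derivative_compose[OF this f]
  have d: "((\<lambda>t. f (t, y)) has_derivative (\<lambda>s. frechet_derivative f (at (x, y)) (s, 0))) (at x)" .
  have "(\<lambda>s. frechet_derivative f (at (x, y)) (s, 0)) = (*) (frechet_derivative f (at (x, y)) (1, 0))"
  proof
    show "frechet_derivative f (at (x, y)) (s, 0) = frechet_derivative f (at (x, y)) (1, 0) * s" for s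
      using linear_scale[OF has_derivative_linear[OF f], of s "(1, 0)"] by simp
  qed
  from d[unfolded this] show ?thesis by (simp only: has_field_derivative_def)
qed

text \<open>By hypothesis \<open>c - i m\<close> rotates with angular velocity
  \<open>- \<kappa>\<close>, and \<open>exp (i T)\<close> adds \<open>T'\<close>. The imaginary part
  of a rotating number changes at the rate angular velocity times real part.\<close>

lemma twist_im_derivative:
  assumes "(c has_real_derivative - (\<kappa> * m x)) (at x)" "(m has_real_derivative \<kappa> * c x) (at x)"
    "(T has_real_derivative T') (at x)"
  shows "((\<lambda>t. twist_im c0 m0 (c t) (m t) (T t)) has_real_derivative
    (T' - \<kappa>) * twist_re c0 m0 (c x) (m x) (T x)) (at x)"
  unfolding twist_im_def twist_re_def
  by (rule DERIV_cong, (rule derivative_intros assms)+) (simp add: algebra_simps)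

section \<open>The target chart and the normal form on \<open>C^1\<close>\<close>

context elliptic_point
begin

definition "V0 = {A \<in> SL2. conf_re conf_unit (adj2 q ** A) > 0}"

lemma chart_on_V0: "chart_on SL2 V0 (sl2_coords q conf_unit anti_unit)"
  unfolding V0_def by (rule chart_on_sl2_coords[OF det_q units])

lemma sr_exp_l0_in_V0: "sr_exp q l0 \<in> V0"
  using components_sr_exp(1)[OF r_pos] n0_pos sr_exp_in_SL2[OF r_pos] by (simp add: V0_def base_values)

text \<open>Once \<open>h$3 = 0\<close>, the other two conditions kill the radial and the angular
  component of \<open>(h$1, h$2)\<close> relative to \<open>(l0$1, l0$2)\<close>; Lagrange's
  identity then gives 0.\<close>

lemma covector_eq_0I:
  assumes "h$3 = 0" "ell_drho l0 h = 0" "h$2 * l0$1 - h$1 * l0$2 - s0\<^sup>2 * (h$3 / 2) = 0"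
  shows "h = 0"
proof -
  have 1: "l0$1 * h$1 + l0$2 * h$2 = 0" "h$2 * l0$1 - h$1 * l0$2 = 0"
    using assms rho_pos by (simp_all add: ell_drho_def)
  have "((l0$1)\<^sup>2 + (l0$2)\<^sup>2) * ((h$1)\<^sup>2 + (h$2)\<^sup>2) = (l0$1 * h$1 + l0$2 * h$2)\<^sup>2 + (h$2 * l0$1 - h$1 * l0$2)\<^sup>2"
    by (simp add: power2_eq_square algebra_simps)
  then have "((l0$1)\<^sup>2 + (l0$2)\<^sup>2) * ((h$1)\<^sup>2 + (h$2)\<^sup>2) = 0"
    unfolding 1 by (simp only: zero_power2 add_0)
  then have "(h$1)\<^sup>2 + (h$2)\<^sup>2 = 0" using H_pos by (metis mult_eq_0_iff less_irrefl)
  then show ?thesis using assms(1) by (simp add: vec3_eq_iff sum_power2_eq_zero_iff)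
qed

lemma open_positive_\<beta>1: "open {l. cov_r l > 0 \<and> \<beta>1 l > 0}"
proof -
  have "{l. cov_r l > 0 \<and> \<beta>1 l > 0} = {l. cov_r l > 0} \<inter> \<beta>1 -` {0<..}" by auto
  moreover have "smooth_on {l. cov_r l > 0} \<beta>1"
    using smooth_on_coordinates(2)[OF open_elliptic] by simp
  ultimately show ?thesis
    using continuous_open_preimage[OF smooth_on_imp_continuous_on open_elliptic open_greaterThan] by metis
qed

lemma has_derivative_a2:
  "(a2 has_derivative (\<lambda>h. (- (sin (ell_rho l0 / 2) / 2) * ell_drho l0 h * m0
     - (ell_s l0 * h$3 + (cos (ell_rho l0 / 2) / 2 * ell_rho l0 - sin (ell_rho l0 / 2)) / (ell_rho l0)\<^sup>2 * ell_drho l0 h * l0$3) * c0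
     + n0\<^sup>2 * (h$3 / 2)) / n0)) (at l0)"
proof -
  have T: "((\<lambda>l. l$3 / 2 - l0$3 / 2) has_derivative (\<lambda>h. h$3 / 2)) (at l0)"
    by (rule has_derivative_eq_rhs, rule has_derivative_diff[OF
          bounded_linear.has_derivative[OF bounded_linear_divide has_derivative_nth] has_derivative_const]) simp
  note d = has_derivative_elliptic[OF r_pos]
  from bounded_linear.has_derivative[OF bounded_linear_divide has_derivative_twist_im_base[OF d(2) has_derivative_mult[OF d(3) has_derivative_nth[of 3]] T], of n0]
  show ?thesis
    unfolding a2_def[abs_def] c0_def[symmetric] m0_def[symmetric] n0_square by simp
qed

text \<open>The identity \<open>ell_s * \<beta>2 = (\<beta>2 / \<beta>1) * (ell_s *
  \<beta>1)\<close> holds wherever \<open>\<beta>1\<close> is positive. The condition defining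
  \<open>C^1\<close> enters through \<open>ell_s\<close>: it vanishes at \<open>l0\<close>, which
  centers the charts, and its differential is a nonzero multiple of \<open>ell_drho\<close>.\<close>

lemma locally_equivalent_conj1:
  assumes "sin (ell_rho l0 / 2) = 0"
  shows "locally_equivalent UNIV SL2 (sr_exp q) l0 (\<lambda>p. vector [p$1 * p$3, p$2, p$3])"
proof (rule locally_equivalentI)
  let ?S = "{l. cov_r l > 0 \<and> \<beta>1 l > 0}"
  let ?\<phi> = "\<lambda>l. vector [\<beta>2 l / \<beta>1 l, a2 l, ell_s l * \<beta>1 l] :: real^3"
  have s: "ell_s l0 = 0" and m: "m0 = 0" using assms by (simp_all add: ell_s_def m0_def)
  have c: "cos (ell_rho l0 / 2) \<noteq> 0" using sin_zero_abs_cos_one[OF assms] by auto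
  show S: "open ?S" by (rule open_positive_\<beta>1)
  have sub: "cov_r l > 0" if "l \<in> ?S" for l using that by simp
  note sm = smooth_on_coordinates[OF S sub] smooth_on_elliptic[OF S sub]
  show "smooth_on ?S ?\<phi>"
    by (intro smooth_on_vector3 smooth_on_divide smooth_on_mult sm S) auto
  show "l0 \<in> ?S" using r_pos s0_pos by (simp add: base_values)
  show "?\<phi> l0 = 0" by (simp add: base_values s vec3_eq_iff)
  show "v = 0" if "frechet_derivative ?\<phi> (at l0) v = 0" for v
  proof (rule frechet_derivative_vector3_injective[OF has_derivative_ratio has_derivative_a2 _ _ that])
    have "(\<beta>1 has_derivative frechet_derivative \<beta>1 (at l0)) (at l0)"
      using smooth_on_has_derivative[OF sm(2) \<open>l0 \<in> ?S\<close>] .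
    from has_derivative_mult[OF has_derivative_elliptic(3)[OF r_pos] this]
    show "((\<lambda>l. ell_s l * \<beta>1 l) has_derivative
       (\<lambda>h. cos (ell_rho l0 / 2) / 2 * ell_rho l0 / (ell_rho l0)\<^sup>2 * ell_drho l0 h * s0)) (at l0)"
      by (simp add: s base_values assms)
    fix h
    assume h: "(h$2 * l0$1 - h$1 * l0$2 - s0\<^sup>2 * (h$3 / 2)) / s0\<^sup>2 = 0"
      "(- (sin (ell_rho l0 / 2) / 2) * ell_drho l0 h * m0
       - (ell_s l0 * h$3 + (cos (ell_rho l0 / 2) / 2 * ell_rho l0 - sin (ell_rho l0 / 2)) / (ell_rho l0)\<^sup>2 * ell_drho l0 h * l0$3) * c0
       + n0\<^sup>2 * (h$3 / 2)) / n0 = 0"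
      "cos (ell_rho l0 / 2) / 2 * ell_rho l0 / (ell_rho l0)\<^sup>2 * ell_drho l0 h * s0 = 0"
    \<comment> \<open>The conditions are triangular: \<open>h(3)\<close> kills the differential of
      \<open>\<rho>\<close>, then \<open>h(2)\<close> reduces to \<open>h$3 = 0\<close>, and
      \<open>h(1)\<close> gives the angular part.\<close>
    have d: "ell_drho l0 h = 0" using h(3) c rho_pos s0_pos by simp
    then have "h$3 = 0" using h(2) n0_pos by (simp add: s)
    then show "h = 0" using covector_eq_0I d h(1) s0_pos by simp
  qed
  show "continuous_on ?S (sr_exp q)" by (rule continuous_on_subset[OF continuous_on_sr_exp]) auto
  show "sr_exp q ` ?S \<subseteq> SL2" using sr_exp_in_SL2 by auto
  show "centered_chart_on SL2 (sr_exp q l0) V0 (sl2_coords q conf_unit anti_unit)"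
    using chart_on_V0 sr_exp_l0_in_V0
    by (simp add: centered_chart_on_def sl2_coords_sr_exp[OF r_pos] base_values s vec3_eq_iff)
  show "sl2_coords q conf_unit anti_unit (sr_exp q l) = vector [?\<phi> l $ 1 * ?\<phi> l $ 3, ?\<phi> l $ 2, ?\<phi> l $ 3]"
    if "l \<in> ?S" for l
    using that by (simp add: sl2_coords_sr_exp mult.commute)
qed

text \<open>\<open>fold_im\<close> expresses \<open>a2\<close> in the variables \<open>x = \<rho> / 2\<close> and \<open>g = |\<beta>|\<^sup>2\<close>: from \<open>g\<close> one recovers
  \<open>s w\<close> up to sign, since \<open>(s w)\<^sup>2 = (sin x)\<^sup>2 + g\<close>, and then \<open>w / 2 = (s w) x / sin x\<close>.\<close>

definition "\<epsilon> = sgn m0"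
definition "fold_m p = \<epsilon> * sqrt ((sin (fst p))\<^sup>2 + snd p)" for p :: "real \<times> real"
definition "fold_T p = fold_m p * fst p / sin (fst p) - l0$3 / 2" for p :: "real \<times> real"
definition "fold_im p = twist_im c0 m0 (cos (fst p)) (fold_m p) (fold_T p) / n0" for p :: "real \<times> real"
definition "fold_re p = twist_re c0 m0 (cos (fst p)) (fold_m p) (fold_T p) / n0" for p :: "real \<times> real"
definition "fold_dom = {p :: real \<times> real. sin (fst p) \<noteq> 0 \<and> snd p > 0}"
definition "fold_g l = (ell_s l)\<^sup>2 * ((l$1)\<^sup>2 + (l$2)\<^sup>2)" for l :: "real^3"

section \<open>The fold in the variables \<open>x\<close> and \<open>g\<close>\<close>

lemma open_fold_dom: "open fold_dom"
  unfolding fold_dom_def by (intro open_Collect_conj open_Collect_neq open_Collect_less continuous_intros)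

lemma smooth_on_fold:
  "smooth_on fold_dom fold_m" "smooth_on fold_dom fold_im" "smooth_on fold_dom fold_re"
proof -
  have sn: "smooth_on fold_dom (\<lambda>p. sin (fst p))" "smooth_on fold_dom (\<lambda>p. cos (fst p))"
    by (simp_all add: smooth_intros open_fold_dom)
  show m: "smooth_on fold_dom fold_m" unfolding fold_m_def[abs_def]
    by (intro smooth_on_mult smooth_on_sqrt smooth_on_add smooth_on_power smooth_on_const sn
        smooth_on_snd smooth_on_ident open_fold_dom) (auto simp: fold_dom_def intro: add_nonneg_pos)
  have "smooth_on fold_dom fold_T" unfolding fold_T_def[abs_def]
    by (intro smooth_on_diff smooth_on_divide smooth_on_mult smooth_on_const sn m
        smooth_on_fst smooth_on_ident open_fold_dom) (auto simp: fold_dom_def)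
  then show "smooth_on fold_dom fold_im" "smooth_on fold_dom fold_re"
    unfolding fold_im_def[abs_def] fold_re_def[abs_def] using n0_pos
    by (auto intro!: smooth_on_divide smooth_on_twist smooth_on_const sn m open_fold_dom)
qed

lemma m0_nonzero: "sin (ell_rho l0 / 2) \<noteq> 0 \<Longrightarrow> m0 \<noteq> 0"
  using l0_3 rho_pos by (simp add: m0_def ell_s_def)

lemma fold_m_square: "m0 \<noteq> 0 \<Longrightarrow> p \<in> fold_dom \<Longrightarrow> (fold_m p)\<^sup>2 = (sin (fst p))\<^sup>2 + snd p"
  by (simp add: fold_m_def power_mult_distrib \<epsilon>_def fold_dom_def sgn_if)

text \<open>For fixed \<open>y\<close> the point \<open>(cos x, fold_m (x, y))\<close> stays on the
  circle of squared radius \<open>1 + y\<close>, so \<open>twist_im_derivative\<close> gives an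
  angular velocity times \<open>fold_re\<close>. That velocity is a multiple of
  \<open>x cos x - sin x\<close>.\<close>

lemma fold_im_partial:
  assumes "m0 \<noteq> 0" "(x, y) \<in> fold_dom"
  shows "((\<lambda>t. fold_im (t, y)) has_real_derivative
    (x * cos x - sin x) * (- (y / (fold_m (x, y) * (sin x)\<^sup>2)) * fold_re (x, y))) (at x)"
proof -
  define M where "M t = fold_m (t, y)" for t
  have sx: "sin x \<noteq> 0" and y: "y > 0" using assms(2) by (auto simp: fold_dom_def)
  have M2: "M x * M x = sin x * sin x + y"
    using fold_m_square[OF assms] by (simp add: M_def power2_eq_square)
  then have Mx: "M x \<noteq> 0" using sx y by (metis add_nonneg_pos mult_zero_left order_less_irrefl zero_le_square)
  \<comment> \<open>The angular velocity on this circle: \<open>cos' = - e M\<close> and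
    \<open>M' = e cos\<close>.\<close>
  define e where "e = sin x / M x"
  have "((\<lambda>t. (sin t)\<^sup>2 + y) has_real_derivative 2 * sin x * cos x) (at x)"
    by (rule DERIV_cong, (rule derivative_intros)+) simp
  moreover have "(sin x)\<^sup>2 + y > 0" using y by (simp add: add_nonneg_pos)
  ultimately have "((\<lambda>t. sqrt ((sin t)\<^sup>2 + y)) has_real_derivative
      inverse (sqrt ((sin x)\<^sup>2 + y)) / 2 * (2 * sin x * cos x)) (at x)"
    by (rule DERIV_chain2[OF DERIV_real_sqrt, rotated])
  from DERIV_cmult[OF this, of \<epsilon>]
  have "(M has_real_derivative \<epsilon> * (inverse (sqrt ((sin x)\<^sup>2 + y)) / 2 * (2 * sin x * cos x))) (at x)"
    unfolding M_def fold_m_def fst_conv snd_conv .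
  moreover have "\<epsilon> * (inverse (sqrt ((sin x)\<^sup>2 + y)) / 2 * (2 * sin x * cos x)) = e * cos x"
    using assms(1) Mx unfolding e_def M_def fold_m_def fst_conv snd_conv
    by (simp add: \<epsilon>_def sgn_if inverse_eq_divide split: if_splits)
  ultimately have M': "(M has_real_derivative e * cos x) (at x)" by (rule DERIV_cong)
  have c': "(cos has_real_derivative - (e * M x)) (at x)"
    using DERIV_cos[of x] Mx by (simp add: e_def)
  define T where "T t = fold_T (t, y)" for t
  have "(T has_real_derivative ((e * cos x * x + M x) * sin x - M x * x * cos x) / (sin x * sin x)) (at x)"
    unfolding T_def fold_T_def fst_conv M_def[symmetric]
    by (rule DERIV_cong, rule DERIV_diff[OF DERIV_divide[OF DERIV_mult[OF M' DERIV_ident] DERIV_sin sx] DERIV_const]) simp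
  from twist_im_derivative[OF c' M' this, of c0 m0]
  have "((\<lambda>t. twist_im c0 m0 (cos t) (M t) (T t)) has_real_derivative
     (((e * cos x * x + M x) * sin x - M x * x * cos x) / (sin x * sin x) - e) * twist_re c0 m0 (cos x) (M x) (T x)) (at x)" .
  from DERIV_cdivide[OF this, of n0]
  have "((\<lambda>t. fold_im (t, y)) has_real_derivative
     (((e * cos x * x + M x) * sin x - M x * x * cos x) / (sin x * sin x) - e) * fold_re (x, y)) (at x)"
    unfolding fold_im_def fold_re_def fst_conv M_def[symmetric] T_def[symmetric] by simp
  moreover have "((e * cos x * x + M x) * sin x - M x * x * cos x) / (sin x * sin x) - e =
      (x * cos x - sin x) * (- (y / (M x * (sin x)\<^sup>2)))"
  proof -
    \<comment> \<open>Substituting \<open>M^2 = (sin x)^2 + y\<close> cancels everything but the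
      terms with factor \<open>y\<close>.\<close>
    have "((sin x * cos x * x + M x * M x) * sin x - M x * M x * x * cos x) - sin x * sin x * sin x =
       - (y * (x * cos x - sin x))"
      unfolding M2 by (simp add: algebra_simps)
    moreover have "((e * cos x * x + M x) * sin x - M x * x * cos x) / (sin x * sin x) - e =
      (((sin x * cos x * x + M x * M x) * sin x - M x * M x * x * cos x) - sin x * sin x * sin x) / (M x * (sin x * sin x))"
      using sx Mx by (simp add: e_def field_simps)
    ultimately show ?thesis by (simp add: power2_eq_square)
  qed
  ultimately show ?thesis by (simp add: M_def mult.assoc)
qed

text \<open>The sign condition says that \<open>ell_s l * l$3\<close> lies on the branch of the
  square root selected by \<open>\<epsilon>\<close>.\<close>

lemma fold_coordinates:
  assumes "cov_r l > 0" "m0 * (ell_s l * l$3) > 0" "(l$1)\<^sup>2 + (l$2)\<^sup>2 > 0"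
  shows "(ell_rho l / 2, fold_g l) \<in> fold_dom" "fold_m (ell_rho l / 2, fold_g l) = ell_s l * l$3"
    "fold_T (ell_rho l / 2, fold_g l) = l$3 / 2 - l0$3 / 2"
proof -
  have \<rho>: "ell_rho l > 0" "(ell_rho l)\<^sup>2 = (l$3)\<^sup>2 - ((l$1)\<^sup>2 + (l$2)\<^sup>2)"
    using assms(1) by (simp_all add: ell_rho_def cov_r_def)
  have s: "ell_s l \<noteq> 0" using assms(2) by auto
  have sin: "sin (ell_rho l / 2) = ell_s l * ell_rho l" using \<rho>(1) by (simp add: ell_s_def)
  show "(ell_rho l / 2, fold_g l) \<in> fold_dom"
    using s \<rho>(1) assms(3) by (simp add: fold_dom_def sin fold_g_def)
  have "(sin (ell_rho l / 2))\<^sup>2 + fold_g l = (ell_s l * l$3)\<^sup>2"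
    by (simp add: sin fold_g_def power_mult_distrib \<rho>(2) algebra_simps)
  then have "fold_m (ell_rho l / 2, fold_g l) = \<epsilon> * \<bar>ell_s l * l$3\<bar>"
    by (simp add: fold_m_def)
  moreover have "\<epsilon> * \<bar>z\<bar> = z" if "m0 * z > 0" for z
    using that by (auto simp: \<epsilon>_def sgn_if zero_less_mult_iff abs_if)
  ultimately show m: "fold_m (ell_rho l / 2, fold_g l) = ell_s l * l$3"
    using assms(2) by simp
  show "fold_T (ell_rho l / 2, fold_g l) = l$3 / 2 - l0$3 / 2"
    unfolding fold_T_def m fst_conv sin using s \<rho>(1) by simp
qed

lemma a2_eq_fold_im:
  assumes "cov_r l > 0" "m0 * (ell_s l * l$3) > 0" "(l$1)\<^sup>2 + (l$2)\<^sup>2 > 0"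
  shows "a2 l = fold_im (ell_rho l / 2, fold_g l)"
  unfolding a2_def fold_im_def fold_coordinates(2,3)[OF assms] by (simp add: ell_c_def)

text \<open>The rotation preserves the modulus of \<open>\<beta>\<close>. Thus \<open>fold_g\<close>
  is the sum of the squares of the first and third target coordinates and can serve as a coordinate
  on both sides.\<close>

lemma fold_g_eq: "fold_g l = (ell_s l * \<beta>1 l)\<^sup>2 + (ell_s l * \<beta>2 l)\<^sup>2"
proof -
  define x y where "x = twist_re (l0$1) (l0$2) (l$1) (l$2) (l$3 / 2 - l0$3 / 2)"
    and "y = twist_im (l0$1) (l0$2) (l$1) (l$2) (l$3 / 2 - l0$3 / 2)"
  have "x\<^sup>2 + y\<^sup>2 = ((l$1)\<^sup>2 + (l$2)\<^sup>2) * s0\<^sup>2"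
    unfolding x_def y_def twist_sum_squares s0_square ..
  moreover have "(\<beta>1 l)\<^sup>2 + (\<beta>2 l)\<^sup>2 = (x\<^sup>2 + y\<^sup>2) / s0\<^sup>2"
    unfolding \<beta>1_def \<beta>2_def x_def[symmetric] y_def[symmetric] by (simp add: power_divide add_divide_distrib)
  ultimately have "(\<beta>1 l)\<^sup>2 + (\<beta>2 l)\<^sup>2 = (l$1)\<^sup>2 + (l$2)\<^sup>2"
    using s0_pos by simp
  then show ?thesis by (simp add: fold_g_def power_mult_distrib flip: distrib_left)
qed

lemma fold_base:
  assumes "sin (ell_rho l0 / 2) \<noteq> 0"
  shows "(ell_rho l0 / 2, fold_g l0) \<in> fold_dom" "fold_m (ell_rho l0 / 2, fold_g l0) = m0"
    "fold_im (ell_rho l0 / 2, fold_g l0) = 0" "fold_re (ell_rho l0 / 2, fold_g l0) = n0"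
proof -
  have p: "m0 * (ell_s l0 * l0$3) > 0"
    using m0_nonzero[OF assms] by (simp add: m0_def[symmetric] flip: power2_eq_square)
  note f = fold_coordinates[OF r_pos p H_pos]
  show "(ell_rho l0 / 2, fold_g l0) \<in> fold_dom" by (rule f(1))
  show m: "fold_m (ell_rho l0 / 2, fold_g l0) = m0" unfolding f(2) m0_def ..
  have t: "l0$3 / 2 - l0$3 / 2 = 0" by simp
  show "fold_im (ell_rho l0 / 2, fold_g l0) = 0" "fold_re (ell_rho l0 / 2, fold_g l0) = n0"
    unfolding fold_im_def fold_re_def m f(3) t fst_conv ell_c_def[symmetric] c0_def[symmetric] twist_base
    using n0_pos by (simp_all flip: n0_square) (simp add: power2_eq_square)
qed

lemma fold_critical:
  assumes "m0 \<noteq> 0" "(x, y) \<in> fold_dom" "x * cos x - sin x = 0"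
  shows "frechet_derivative fold_im (at (x, y)) (1, 0) = 0"
  using DERIV_unique[OF smooth_on_partial_fst[OF smooth_on_fold(2) assms(2)] fold_im_partial[OF assms(1,2)]] assms(3)
  by simp

text \<open>The first derivative is \<open>x cos x - sin x\<close> times a nonvanishing
  \<open>W\<close>. At a zero of the first factor the product rule leaves its derivative
  \<open>- x sin x\<close> times \<open>W\<close>.\<close>

lemma fold_nondegenerate:
  assumes "m0 \<noteq> 0" "(x, y) \<in> fold_dom" "x * cos x - sin x = 0" "x \<noteq> 0" "fold_re (x, y) \<noteq> 0"
  shows "frechet_derivative (\<lambda>p. frechet_derivative fold_im (at p) (1, 0)) (at (x, y)) (1, 0) \<noteq> 0"
proof -
  define W where "W p = - (snd p / (fold_m p * (sin (fst p))\<^sup>2)) * fold_re p" for p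
  have nz: "fold_m p \<noteq> 0" "sin (fst p) \<noteq> 0" "snd p > 0" if "p \<in> fold_dom" for p
  proof -
    show "sin (fst p) \<noteq> 0" "snd p > 0" using that by (simp_all add: fold_dom_def)
    then have "(fold_m p)\<^sup>2 > 0" unfolding fold_m_square[OF assms(1) that] by (intro add_nonneg_pos) simp_all
    then show "fold_m p \<noteq> 0" by auto
  qed
  have "smooth_on fold_dom W" unfolding W_def[abs_def]
    using nz by (intro smooth_on_mult smooth_on_minus smooth_on_divide smooth_on_power smooth_on_snd smooth_on_fst
        smooth_on_sin smooth_on_ident smooth_on_fold open_fold_dom) auto
  from smooth_on_partial_fst[OF this assms(2)]
  obtain W' where W': "((\<lambda>t. W (t, y)) has_real_derivative W') (at x)" by blast
  have "((\<lambda>t. t * cos t - sin t) has_real_derivative - x * sin x) (at x)"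
    by (rule DERIV_cong, (rule derivative_intros)+) simp
  from DERIV_mult[OF this W']
  have 1: "((\<lambda>t. (t * cos t - sin t) * W (t, y)) has_real_derivative - x * sin x * W (x, y)) (at x)"
    using assms(3) by simp
  have 2: "(t * cos t - sin t) * W (t, y) = frechet_derivative fold_im (at (t, y)) (1, 0)" if "t \<in> {t. sin t \<noteq> 0}" for t
  proof -
    have "(t, y) \<in> fold_dom" using that assms(2) by (simp add: fold_dom_def)
    from DERIV_unique[OF fold_im_partial[OF assms(1) this] smooth_on_partial_fst[OF smooth_on_fold(2) this]]
    show ?thesis by (simp add: W_def)
  qed
  have 3: "open {t :: real. sin t \<noteq> 0}" by (intro open_Collect_neq continuous_intros)
  have 4: "x \<in> {t. sin t \<noteq> 0}" using nz(2)[OF assms(2)] by simp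
  from has_field_derivative_transform_within_open[OF 1 3 4 2]
  have "((\<lambda>t. frechet_derivative fold_im (at (t, y)) (1, 0)) has_real_derivative - x * sin x * W (x, y)) (at x)" .
  from DERIV_unique[OF smooth_on_partial_fst[OF smooth_on_frechet_derivative[OF smooth_on_fold(2)] assms(2)] this]
  show ?thesis using assms(4,5) nz[OF assms(2)] by (simp add: W_def)
qed

lemma has_derivative_fold_g:
  "(fold_g has_derivative (\<lambda>h. 2 * ell_s l0 * (((cos (ell_rho l0 / 2) / 2 * ell_rho l0 - sin (ell_rho l0 / 2)) / (ell_rho l0)\<^sup>2) * ell_drho l0 h) * s0\<^sup>2
     + (ell_s l0)\<^sup>2 * (2 * (l0$1 * h$1 + l0$2 * h$2)))) (at l0)"
  unfolding fold_g_def[abs_def]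
  by (rule has_derivative_eq_rhs, (rule derivative_intros has_derivative_nth has_derivative_elliptic(3)[OF r_pos])+)
    (simp add: s0_square fun_eq_iff algebra_simps)

section \<open>The normal form on \<open>C^0\<close>\<close>

text \<open>Source and target share the coordinates \<open>Im \<beta> / Re \<beta>\<close> and
  \<open>|\<beta>|^2 - y0\<close>. The third one is \<open>X\<close> in the source; in the target it
  is the signed increment of \<open>Im \<alpha>\<close> from its critical value, which pulls back to
  \<open>X^2\<close>.\<close>

lemma locally_equivalent_conj0:
  assumes cl: "ell_rho l0 * cos (ell_rho l0 / 2) = 2 * sin (ell_rho l0 / 2)"
  shows "locally_equivalent UNIV SL2 (sr_exp q) l0 (\<lambda>p. vector [(p$1)\<^sup>2, p$2, p$3])"
proof -
  define x0 where "x0 = ell_rho l0 / 2"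
  define y0 where "y0 = fold_g l0"
  \<comment> \<open>If the sine vanished, \<open>cl\<close> would force the cosine to vanish as
    well.\<close>
  have sin0: "sin x0 \<noteq> 0"
    using cl rho_pos sin_zero_abs_cos_one[of x0] by (auto simp: x0_def)
  have x0: "x0 > 0" "x0 * cos x0 - sin x0 = 0" using rho_pos cl by (simp_all add: x0_def)
  have m: "m0 \<noteq> 0" and sl0: "ell_s l0 \<noteq> 0"
    using m0_nonzero sin0 by (auto simp: x0_def m0_def)
  note base = fold_base[OF sin0[unfolded x0_def], folded x0_def y0_def]
  have nd: "frechet_derivative (\<lambda>p. frechet_derivative fold_im (at p) (1, 0)) (at (x0, y0)) (1, 0) \<noteq> 0"
    using fold_nondegenerate[OF m base(1) x0(2)] x0(1) base(4) n0_pos by simp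
  obtain N X \<eta> c where N: "open N" "(x0, y0) \<in> N" "N \<subseteq> fold_dom" and X: "smooth_on N X"
    and c: "c \<noteq> 0" and \<eta>: "\<eta> \<in> {-1, 1}"
    and sq: "\<And>x y. (x, y) \<in> N \<Longrightarrow> (x0, y) \<in> fold_dom \<and> (X (x, y))\<^sup>2 = \<eta> * (fold_im (x, y) - fold_im (x0, y))"
    and X0: "X (x0, y0) = 0" and dX: "(X has_derivative (\<lambda>v. c * fst v)) (at (x0, y0))"
    by (rule morse_with_parameters[OF open_fold_dom base(1) smooth_on_fold(2) fold_critical[OF m _ x0(2)] nd]) metis+

  define S1 where "S1 = {l. cov_r l > 0 \<and> \<beta>1 l > 0}"
  \<comment> \<open>\<open>\<Phi>\<close> gathers the sign conditions of
    \<open>fold_coordinates\<close> and membership in \<open>N\<close>, so that \<open>S\<close> is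
    open as one preimage.\<close>
  define \<Phi> where "\<Phi> l = (m0 * (ell_s l * l$3), (l$1)\<^sup>2 + (l$2)\<^sup>2, ell_rho l / 2, fold_g l)" for l
  define S where "S = S1 \<inter> \<Phi> -` ({0<..} \<times> {0<..} \<times> N)"
  have S1: "open S1" unfolding S1_def by (rule open_positive_\<beta>1)
  have pos1: "cov_r l > 0" if "l \<in> S1" for l using that by (simp add: S1_def)
  note el = smooth_on_elliptic[OF S1 pos1]
  have sg: "smooth_on S1 (\<lambda>l. (ell_rho l / 2, fold_g l))" unfolding fold_g_def
    by (intro smooth_on_Pair smooth_on_mult smooth_on_power smooth_on_add smooth_on_divide smooth_on_nth
        smooth_on_ident smooth_on_const el S1) simp
  have "smooth_on S1 \<Phi>" unfolding \<Phi>_def[abs_def]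
    by (intro smooth_on_Pair[OF S1 _ smooth_on_Pair[OF S1 _ sg]] smooth_on_mult smooth_on_power smooth_on_add smooth_on_nth
        smooth_on_ident smooth_on_const el S1)
  then have S: "open S" unfolding S_def
    by (intro continuous_open_preimage smooth_on_imp_continuous_on S1 open_Times open_greaterThan N(1))
  have memS: "cov_r l > 0" "\<beta>1 l > 0" "m0 * (ell_s l * l$3) > 0" "(l$1)\<^sup>2 + (l$2)\<^sup>2 > 0" "(ell_rho l / 2, fold_g l) \<in> N"
    if "l \<in> S" for l
    using that by (auto simp: S_def S1_def \<Phi>_def)
  have l0S: "l0 \<in> S"
    using r_pos s0_pos N(2) H_pos m
    by (simp add: S_def S1_def \<Phi>_def base_values x0_def[symmetric] y0_def[symmetric] m0_def[symmetric] flip: power2_eq_square)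
  let ?\<phi> = "\<lambda>l. vector [X (ell_rho l / 2, fold_g l), \<beta>2 l / \<beta>1 l, fold_g l - y0] :: real^3"
  define b where "b = ell_s l0 * s0"
  have b: "b \<noteq> 0" using sl0 s0_pos by (simp add: b_def)
  have b2: "b\<^sup>2 = y0" unfolding y0_def fold_g_eq by (simp add: base_values b_def)
  \<comment> \<open>The subtracted value of \<open>fold_im\<close> depends only on the target
    variables \<open>y$1\<close> and \<open>y$3\<close>; it straightens the set of critical values
    into a coordinate plane. The factor \<open>\<eta>\<close> turns the signed square into a
    square.\<close>
  define \<kappa> where "\<kappa> y = (vector [\<eta> * (y$2 - fold_im (x0, (y$1)\<^sup>2 + (y$3)\<^sup>2)), y$1 / y$3, (y$1)\<^sup>2 + (y$3)\<^sup>2 - y0] :: real^3)" for y :: "real^3"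
  let ?D = "{y :: real^3. y$3 \<noteq> 0}" and ?p = "vector [0, 0, b] :: real^3"
  have D: "open ?D" by (intro open_Collect_neq continuous_intros)
  have "smooth_on ?D (\<lambda>y. fold_im (x0, (y$1)\<^sup>2 + (y$3)\<^sup>2))"
    by (rule smooth_on_compose[OF smooth_on_fold(2) D open_fold_dom])
      (use sin0 in \<open>simp_all add: fold_dom_def add_nonneg_pos smooth_intros D\<close>)
  then have s\<kappa>: "smooth_on ?D \<kappa>" unfolding \<kappa>_def[abs_def]
    by (intro smooth_on_vector3 smooth_on_divide smooth_on_mult smooth_on_diff smooth_on_add smooth_on_power
        smooth_on_nth smooth_on_const smooth_on_ident D) auto
  have inj\<kappa>: "v = 0" if "frechet_derivative \<kappa> (at ?p) v = 0" for v
  proof (rule frechet_derivative_vector3_injective[OF _ _ _ _ that[unfolded \<kappa>_def[abs_def]]])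
    \<comment> \<open>At \<open>?p\<close> the first entry is 0, so only \<open>y$3\<close>
      contributes to the differential.\<close>
    have d: "((\<lambda>y :: real^3. (y$1)\<^sup>2 + (y$3)\<^sup>2) has_derivative (\<lambda>h. 2 * b * h$3)) (at ?p)"
      by (rule has_derivative_eq_rhs, (rule derivative_intros has_derivative_nth)+) (simp add: fun_eq_iff)
    then show "((\<lambda>y :: real^3. (y$1)\<^sup>2 + (y$3)\<^sup>2 - y0) has_derivative (\<lambda>h. 2 * b * h$3)) (at ?p)"
      by (rule has_derivative_eq_rhs[OF has_derivative_diff[OF _ has_derivative_const]]) simp
    show "((\<lambda>y :: real^3. y$1 / y$3) has_derivative (\<lambda>h. h$1 / b)) (at ?p)"
      by (rule has_derivative_eq_rhs, rule has_derivative_divide'[OF has_derivative_nth has_derivative_nth])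
        (use b in \<open>simp_all add: fun_eq_iff\<close>)
    let ?F = "frechet_derivative fold_im (at (x0, y0))"
    have F: "(fold_im has_derivative ?F) (at (x0, y0))"
      by (rule smooth_on_has_derivative[OF smooth_on_fold(2) base(1)])
    have e: "(x0, (?p $ 1)\<^sup>2 + (?p $ 3)\<^sup>2) = (x0, y0)" by (simp add: b2)
    have "((\<lambda>y :: real^3. fold_im (x0, (y$1)\<^sup>2 + (y$3)\<^sup>2)) has_derivative (\<lambda>h. ?F (0, 2 * b * h$3))) (at ?p)"
      by (rule has_derivative_compose[OF has_derivative_Pair[OF has_derivative_const d]]) (simp only: e F)
    then show "((\<lambda>y :: real^3. \<eta> * (y$2 - fold_im (x0, (y$1)\<^sup>2 + (y$3)\<^sup>2))) has_derivative
        (\<lambda>h. \<eta> * (h$2 - ?F (0, 2 * b * h$3)))) (at ?p)"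
      by (intro has_derivative_mult_right has_derivative_diff has_derivative_nth)
    fix h :: "real^3"
    assume h: "\<eta> * (h$2 - ?F (0, 2 * b * h$3)) = 0" "h$1 / b = 0" "2 * b * h$3 = 0"
    have "?F 0 = 0" using linear_0[OF has_derivative_linear[OF F]] .
    with h(3) have "?F (0, 2 * b * h$3) = 0" by (simp only: zero_prod_def)
    then have "h$2 = 0" using h(1) \<eta> by auto
    then show "h = 0" using h(2,3) b by (simp add: vec3_eq_iff)
  qed
  obtain U where U: "open U" "?p \<in> U" "U \<subseteq> ?D" "chart_on UNIV U \<kappa>"
    using local_diffeo_chart_on[OF D s\<kappa>, of ?p] inj\<kappa> b by auto
  have coords0: "sl2_coords q conf_unit anti_unit (sr_exp q l0) = ?p"
    by (simp add: sl2_coords_sr_exp[OF r_pos] base_values b_def)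
  show ?thesis
  proof (rule locally_equivalentI[OF S])
    have SS1: "S \<subseteq> S1" by (auto simp: S_def)
    have pos: "cov_r l > 0" if "l \<in> S" for l using memS(1)[OF that] .
    note sm = smooth_on_coordinates[OF S pos]
    have "smooth_on S (\<lambda>l. X (ell_rho l / 2, fold_g l))"
      by (rule smooth_on_compose[OF X S N(1) memS(5) smooth_on_subset[OF sg SS1]])
    moreover have "smooth_on S fold_g"
      using smooth_on_snd[OF S smooth_on_subset[OF sg SS1]] by simp
    moreover have "smooth_on S (\<lambda>l. \<beta>2 l / \<beta>1 l)"
      using memS(2) by (intro smooth_on_divide sm S) (metis less_irrefl)
    ultimately show "smooth_on S ?\<phi>"
      by (intro smooth_on_vector3 smooth_on_diff smooth_on_const S)
    show "l0 \<in> S" by (rule l0S)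
    show "?\<phi> l0 = 0"
      by (simp add: base_values X0 vec3_eq_iff flip: x0_def y0_def)
    show "v = 0" if "frechet_derivative ?\<phi> (at l0) v = 0" for v
    proof (rule frechet_derivative_vector3_injective[OF _ has_derivative_ratio _ _ that])
      show "((\<lambda>l. fold_g l - y0) has_derivative
         (\<lambda>h. 2 * ell_s l0 * (((cos (ell_rho l0 / 2) / 2 * ell_rho l0 - sin (ell_rho l0 / 2)) / (ell_rho l0)\<^sup>2) * ell_drho l0 h) * s0\<^sup>2
     + (ell_s l0)\<^sup>2 * (2 * (l0$1 * h$1 + l0$2 * h$2)))) (at l0)"
        by (rule has_derivative_eq_rhs[OF has_derivative_diff[OF has_derivative_fold_g has_derivative_const]]) simp
      have "((\<lambda>l. (ell_rho l / 2, fold_g l)) has_derivative (\<lambda>h. (ell_drho l0 h / 2, frechet_derivative fold_g (at l0) h))) (at l0)"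
        by (intro has_derivative_Pair bounded_linear.has_derivative[OF bounded_linear_divide]
            has_derivative_elliptic(1)[OF r_pos] has_derivative_fold_g[THEN differentiableI, unfolded frechet_derivative_works])
      from has_derivative_compose[OF this, of X "\<lambda>v. c * fst v"] dX
      show "((\<lambda>l. X (ell_rho l / 2, fold_g l)) has_derivative (\<lambda>h. c * (ell_drho l0 h / 2))) (at l0)"
        by (simp add: x0_def y0_def)
      fix h
      assume h: "c * (ell_drho l0 h / 2) = 0" "(h$2 * l0$1 - h$1 * l0$2 - s0\<^sup>2 * (h$3 / 2)) / s0\<^sup>2 = 0"
        "2 * ell_s l0 * (((cos (ell_rho l0 / 2) / 2 * ell_rho l0 - sin (ell_rho l0 / 2)) / (ell_rho l0)\<^sup>2) * ell_drho l0 h) * s0\<^sup>2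
         + (ell_s l0)\<^sup>2 * (2 * (l0$1 * h$1 + l0$2 * h$2)) = 0"
      \<comment> \<open>Triangular again: \<open>X\<close> kills the differential of
        \<open>\<rho>\<close>, then that of \<open>fold_g\<close> kills the radial part of
        \<open>(h$1, h$2)\<close>. Both together give \<open>l0$3 * h$3 = 0\<close>, and
        \<open>l0$3\<close> is nonzero.\<close>
      have d: "ell_drho l0 h = 0" using h(1) c by simp
      have "l0$1 * h$1 + l0$2 * h$2 = 0" using h(3) sl0 unfolding d by simp
      moreover have "l0$3 * h$3 - l0$1 * h$1 - l0$2 * h$2 = 0" using d rho_pos by (simp add: ell_drho_def)
      ultimately have "l0$3 * h$3 = 0" by linarith
      then have "h$3 = 0" using l0_3 by simp
      then show "h = 0" using covector_eq_0I d h(2) s0_pos by simp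
    qed
    show "continuous_on S (sr_exp q)"
      by (rule continuous_on_subset[OF continuous_on_sr_exp]) (auto dest: pos)
    show "sr_exp q ` S \<subseteq> SL2" using sr_exp_in_SL2 pos by auto
    show "centered_chart_on SL2 (sr_exp q l0) (V0 \<inter> sl2_coords q conf_unit anti_unit -` U)
        (\<lambda>A. \<kappa> (sl2_coords q conf_unit anti_unit A))"
      using chart_on_compose[OF chart_on_V0 U(4)] sr_exp_l0_in_V0 U(2) base(3)
      by (simp add: centered_chart_on_def coords0) (simp add: \<kappa>_def b2 vec3_eq_iff)
    show "\<kappa> (sl2_coords q conf_unit anti_unit (sr_exp q l)) = vector [(?\<phi> l $ 1)\<^sup>2, ?\<phi> l $ 2, ?\<phi> l $ 3]"
      if "l \<in> S" for l
    proof -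
      note l = memS[OF that]
      have "ell_s l \<noteq> 0" using l(3) by auto
      moreover have g: "(ell_s l * \<beta>2 l)\<^sup>2 + (ell_s l * \<beta>1 l)\<^sup>2 = fold_g l" by (simp add: fold_g_eq)
      ultimately show ?thesis
        using sq[OF l(5)] by (simp add: \<kappa>_def sl2_coords_sr_exp[OF l(1)] g a2_eq_fold_im[OF l(1,3,4)] del: power_mult_distrib)
    qed
  qed
qed

end

section \<open>Both parts of the conjugate locus\<close>

theorem theorem24:
  fixes q :: "real^2^2"
  assumes "q \<in> SL2"
  shows "(\<forall>l\<in>conj_locus0 q. locally_equivalent UNIV SL2 (sr_exp q) l
            (\<lambda>p. vector [(p$1)\<^sup>2, p$2, p$3])) \<and>
         (\<forall>l\<in>conj_locus1 q. locally_equivalent UNIV SL2 (sr_exp q) l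
            (\<lambda>p. vector [p$1 * p$3, p$2, p$3]))"
proof (intro conjI ballI)
  have ell: "elliptic_point q l" if "sr_hamiltonian (q, l) \<noteq> 0" "cov_r l > 0" for l
  proof
    show "det q = 1" using assms by (simp add: SL2_def)
    show "(l$1)\<^sup>2 + (l$2)\<^sup>2 > 0" using that(1) by (simp add: sr_hamiltonian_def sum_power2_gt_zero_iff)
  qed (rule that(2))
  fix l
  show "locally_equivalent UNIV SL2 (sr_exp q) l (\<lambda>p. vector [(p$1)\<^sup>2, p$2, p$3])" if "l \<in> conj_locus0 q"
  proof -
    interpret elliptic_point q l using ell that by (simp add: conj_locus0_def)
    show ?thesis using that by (intro locally_equivalent_conj0) (simp add: conj_locus0_def ell_rho_def)
  qed
  show "locally_equivalent UNIV SL2 (sr_exp q) l (\<lambda>p. vector [p$1 * p$3, p$2, p$3])" if "l \<in> conj_locus1 q"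
  proof -
    interpret elliptic_point q l using ell that by (simp add: conj_locus1_def)
    show ?thesis using that by (intro locally_equivalent_conj1) (simp add: conj_locus1_def ell_rho_def)
  qed
qed

end
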